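(* Let $\mathcal{A}$ be a commutative unital locally $C^{\ast}$-algebra with topology given by the upward filtered family $\{p_\alpha\}_{\alpha\in\Lambda}$ of $C^{\ast}$-seminorms. Then the map $\Gamma:\mathcal{A}\to C(\mathcal{M}_{\mathcal{A}})$ defined by $$\Gamma(a)(\varphi_\alpha\circ\pi_\alpha)=\varphi_\alpha(\pi_\alpha(a)),\qquad a\in\mathcal{A},\ \alpha\in\Lambda,\ \varphi_\alpha\in\mathcal{M}_{\mathcal{A}_\alpha},$$ is a coherent representation of the locally $C^{\ast}$-algebras $\mathcal{A}$ and $C(\mathcal{M}_{\mathcal{A}})$. In fact, $\Gamma$ is a unital local contractive (isometric) $\ast$-homomorphism.
   Context: A $C^{\ast}$-seminorm on a unital complex $\ast$-algebra $\mathcal{A}$ is a seminorm $p$ with $p(1)=1$, $p(ab)\le p(a)p(b)$, $p(a^{\ast})=p(a)$, $p(a^{\ast}a)=p(a)^2$. Let $(\Lambda,\le)$ be a directed partially ordered set. A family $\{p_\alpha\}_{\alpha\in\Lambda}$ is upward filtered if $p_\alpha(a)\le p_\beta(a)$ for all $a$ whenever $\alpha\le\beta$. $\mathcal{A}$ is a (unital) locally $C^{\ast}$-algebra if it has a complete Hausdorff locally convex topology induced by an upward filtered family $\{p_\alpha\}_{\alpha\in\Lambda}$ of $C^{\ast}$-seminorms. Put $\mathcal{I}_\alpha=\{a\in\mathcal{A}: p_\alpha(a)=0\}$, $\mathcal{A}_\alpha=\mathcal{A}/\mathcal{I}_\alpha$ (a $C^{\ast}$-algebra with norm $\|a+\mathcal{I}_\alpha\|=p_\alpha(a)$),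 and $\pi_\alpha:\mathcal{A}\to\mathcal{A}_\alpha$ the quotient map; $\mathcal{A}$ is the projective limit of the $\mathcal{A}_\alpha$ with maps $\pi_\alpha$. $\mathcal{M}_{\mathcal{A}_\alpha}$ is the set of nonzero multiplicative linear functionals on $\mathcal{A}_\alpha$ with the weak$^{\ast}$-topology (compact Hausdorff). The character space is $\mathcal{M}_{\mathcal{A}}=\{\varphi_\alpha\circ\pi_\alpha:\alpha\in\Lambda,\ \varphi_\alpha\in\mathcal{M}_{\mathcal{A}_\alpha}\}=\bigcup_\alpha\mathcal{Z}_\alpha$, where $\mathcal{Z}_\alpha=\{\varphi_\alpha\circ\pi_\alpha:\varphi_\alpha\in\mathcal{M}_{\mathcal{A}_\alpha}\}$ has as open sets the sets $\{\varphi_\alpha\circ\pi_\alpha:\varphi_\alpha\in\mathcal{O}\}$ with $\mathcal{O}$ open in $\mathcal{M}_{\mathcal{A}_\alpha}$. $\mathcal{M}_{\mathcal{A}}$ carries the inductive limit topology $\{S: S\cap\mathcal{Z}_\alpha\text{ is open in }\mathcal{Z}_\alpha\text{ for all }\alpha\}$. Put $\gamma_\alpha:\mathcal{M}_{\mathcal{A}_\alpha}\to\mathcal{M}_{\mathcal{A}}$, $\varphi\mapsto\varphi\circ\pi_\alpha$. $C(\mathcal{M}_{\mathcal{A}})$ is the $\ast$-algebra of continuous complex-valued functions on $\mathcal{M}_{\mathcal{A}}$ with the locally convex topology induced by the $C^{\ast}$-seminorms $q_\alpha(f)=\|f\circ\gamma_\alpha\|_\infty$, $\alpha\in\Lambda$;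 it is the projective limit of the $C^{\ast}$-algebras $C(\mathcal{M}_{\mathcal{A}_\alpha})$ with maps $\xi_\alpha:C(\mathcal{M}_{\mathcal{A}})\to C(\mathcal{M}_{\mathcal{A}_\alpha})$, $\xi_\alpha(f)=f\circ\gamma_\alpha$. "$\Gamma$ is a coherent representation" means: $\Gamma$ is a $\ast$-homomorphism and there is a net $\{\Gamma_\alpha\}_{\alpha\in\Lambda}$ of $\ast$-homomorphisms $\Gamma_\alpha:\mathcal{A}_\alpha\to C(\mathcal{M}_{\mathcal{A}_\alpha})$ with $\xi_\alpha\circ\Gamma=\Gamma_\alpha\circ\pi_\alpha$ for all $\alpha\in\Lambda$. "Local contractive (isometric)" means $q_\alpha(\Gamma(a))\le p_\alpha(a)$ (respectively $q_\alpha(\Gamma(a))=p_\alpha(a)$) for all $a\in\mathcal{A}$ and $\alpha\in\Lambda$; the isometric version is asserted. *)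

theory Defs
  imports "HOL-Analysis.Analysis" "HOL-Algebra.QuotRing" "HOL-Algebra.Module"
begin

section \<open>Complex \<open>*\<close>-algebras\<close>

definition complex_scalars :: "complex ring" where
  "complex_scalars = \<lparr>carrier = UNIV, mult = (*), one = 1, zero = 0, add = (+)\<rparr>"

record 'a star_algebra = "(complex, 'a) module" +
  invol :: "'a \<Rightarrow> 'a"

locale complex_star_algebra = Module.module complex_scalars A + ring A
  for A :: "'a star_algebra" (structure) +
  assumes smult_mult_left:
      "\<lbrakk>x \<in> carrier A; y \<in> carrier A\<rbrakk> \<Longrightarrow> (c \<odot> x) \<otimes> y = c \<odot> (x \<otimes> y)"
    and smult_mult_right:
      "\<lbrakk>x \<in> carrier A; y \<in> carrier A\<rbrakk> \<Longrightarrow> x \<otimes> (c \<odot> y) = c \<odot> (x \<otimes> y)"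
    and invol_closed: "x \<in> carrier A \<Longrightarrow> invol A x \<in> carrier A"
    and invol_invol: "x \<in> carrier A \<Longrightarrow> invol A (invol A x) = x"
    and invol_add:
      "\<lbrakk>x \<in> carrier A; y \<in> carrier A\<rbrakk> \<Longrightarrow> invol A (x \<oplus> y) = invol A x \<oplus> invol A y"
    and invol_smult: "x \<in> carrier A \<Longrightarrow> invol A (c \<odot> x) = cnj c \<odot> invol A x"
    and invol_mult:
      "\<lbrakk>x \<in> carrier A; y \<in> carrier A\<rbrakk> \<Longrightarrow> invol A (x \<otimes> y) = invol A y \<otimes> invol A x"

text \<open>Preservation of the unit is not part of the definition of a \<open>*\<close>-homomorphism.\<close>

definition star_hom :: "'a star_algebra \<Rightarrow> 'b star_algebra \<Rightarrow> ('a \<Rightarrow> 'b) set" where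
  "star_hom A B = {h \<in> carrier A \<rightarrow> carrier B.
     (\<forall>x\<in>carrier A. \<forall>y\<in>carrier A. h (x \<oplus>\<^bsub>A\<^esub> y) = h x \<oplus>\<^bsub>B\<^esub> h y) \<and>
     (\<forall>c. \<forall>x\<in>carrier A. h (c \<odot>\<^bsub>A\<^esub> x) = c \<odot>\<^bsub>B\<^esub> h x) \<and>
     (\<forall>x\<in>carrier A. \<forall>y\<in>carrier A. h (x \<otimes>\<^bsub>A\<^esub> y) = h x \<otimes>\<^bsub>B\<^esub> h y) \<and>
     (\<forall>x\<in>carrier A. h (invol A x) = invol B (h x))}"


section \<open>Locally C\<open>*\<close>-algebras\<close>

definition cstar_seminorm :: "'a star_algebra \<Rightarrow> ('a \<Rightarrow> real) \<Rightarrow> bool" where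
  "cstar_seminorm A p \<longleftrightarrow>
     (\<forall>x\<in>carrier A. 0 \<le> p x) \<and>
     (\<forall>x\<in>carrier A. \<forall>y\<in>carrier A. p (x \<oplus>\<^bsub>A\<^esub> y) \<le> p x + p y) \<and>
     (\<forall>c. \<forall>x\<in>carrier A. p (c \<odot>\<^bsub>A\<^esub> x) = cmod c * p x) \<and>
     p \<one>\<^bsub>A\<^esub> = 1 \<and>
     (\<forall>x\<in>carrier A. \<forall>y\<in>carrier A. p (x \<otimes>\<^bsub>A\<^esub> y) \<le> p x * p y) \<and>
     (\<forall>x\<in>carrier A. p (invol A x) = p x) \<and>
     (\<forall>x\<in>carrier A. p (invol A x \<otimes>\<^bsub>A\<^esub> x) = (p x)\<^sup>2)"

definition directed_poset :: "'i set \<Rightarrow> 'i rel \<Rightarrow> bool" where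
  "directed_poset \<Lambda> r \<longleftrightarrow> \<Lambda> \<noteq> {} \<and> partial_order_on \<Lambda> r \<and>
     (\<forall>\<alpha>\<in>\<Lambda>. \<forall>\<beta>\<in>\<Lambda>. \<exists>\<gamma>\<in>\<Lambda>. (\<alpha>, \<gamma>) \<in> r \<and> (\<beta>, \<gamma>) \<in> r)"

definition upward_filtered ::
    "'a star_algebra \<Rightarrow> 'i rel \<Rightarrow> ('i \<Rightarrow> 'a \<Rightarrow> real) \<Rightarrow> bool" where
  "upward_filtered A r p \<longleftrightarrow> (\<forall>(\<alpha>, \<beta>)\<in>r. \<forall>x\<in>carrier A. p \<alpha> x \<le> p \<beta> x)"

definition seminorm_topology ::
    "'a star_algebra \<Rightarrow> 'i set \<Rightarrow> ('i \<Rightarrow> 'a \<Rightarrow> real) \<Rightarrow> 'a topology" where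
  "seminorm_topology A \<Lambda> p = topology (\<lambda>U. U \<subseteq> carrier A \<and>
     (\<forall>x\<in>U. \<exists>F e. finite F \<and> F \<subseteq> \<Lambda> \<and> 0 < e \<and>
        {y \<in> carrier A. \<forall>\<alpha>\<in>F. p \<alpha> (y \<ominus>\<^bsub>A\<^esub> x) < e} \<subseteq> U))"

lemma openin_seminorm_topology:
  "openin (seminorm_topology A \<Lambda> p) U \<longleftrightarrow> U \<subseteq> carrier A \<and>
     (\<forall>x\<in>U. \<exists>F e. finite F \<and> F \<subseteq> \<Lambda> \<and> 0 < e \<and>
        {y \<in> carrier A. \<forall>\<alpha>\<in>F. p \<alpha> (y \<ominus>\<^bsub>A\<^esub> x) < e} \<subseteq> U)"
proof -
  let ?nb = "\<lambda>x F e. {y \<in> carrier A. \<forall>\<alpha>\<in>F. p \<alpha> (y \<ominus>\<^bsub>A\<^esub> x) < e}"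
  let ?P = "\<lambda>x U. \<exists>F e. finite F \<and> F \<subseteq> \<Lambda> \<and> (0::real) < e \<and> ?nb x F e \<subseteq> U"
  have "istopology (\<lambda>U. U \<subseteq> carrier A \<and> (\<forall>x\<in>U. ?P x U))"
    unfolding istopology_def
  proof (intro conjI allI impI)
    fix S T assume S: "S \<subseteq> carrier A \<and> (\<forall>x\<in>S. ?P x S)"
      and T: "T \<subseteq> carrier A \<and> (\<forall>x\<in>T. ?P x T)"
    show "S \<inter> T \<subseteq> carrier A" using S by blast
    show "\<forall>x\<in>S \<inter> T. ?P x (S \<inter> T)"
    proof
      fix x assume x: "x \<in> S \<inter> T"
      obtain F e where F: "finite F" "F \<subseteq> \<Lambda>" "0 < e" "?nb x F e \<subseteq> S"
        using S x by blast
      obtain G d where G: "finite G" "G \<subseteq> \<Lambda>" "0 < d" "?nb x G d \<subseteq> T"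
        using T x by blast
      have "?nb x (F \<union> G) (min e d) \<subseteq> S \<inter> T"
        using F(4) G(4) by auto
      then show "?P x (S \<inter> T)"
        using F G by (intro exI[of _ "F \<union> G"] exI[of _ "min e d"]) auto
    qed
  next
    fix K assume K: "\<forall>U\<in>K. U \<subseteq> carrier A \<and> (\<forall>x\<in>U. ?P x U)"
    show "\<Union>K \<subseteq> carrier A" using K by blast
    show "\<forall>x\<in>\<Union>K. ?P x (\<Union>K)"
    proof
      fix x assume "x \<in> \<Union>K"
      then obtain U where U: "U \<in> K" "x \<in> U" by blast
      then have "?P x U" using bspec[OF K U(1)] by simp
      then obtain F e where F: "finite F" "F \<subseteq> \<Lambda>" "0 < e" "?nb x F e \<subseteq> U"
        by (elim exE conjE)
      have "?nb x F e \<subseteq> \<Union>K"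
        using F(4) Union_upper[OF U(1)] by (rule order_trans)
      then show "?P x (\<Union>K)" using F(1-3) by (intro exI conjI)
    qed
  qed
  then show ?thesis
    by (simp add: seminorm_topology_def topology_inverse')
qed

text \<open>Completeness is formulated with Cauchy filters, which is equivalent to
  convergence of all Cauchy nets.\<close>

definition cauchy_filter ::
    "'a star_algebra \<Rightarrow> 'i set \<Rightarrow> ('i \<Rightarrow> 'a \<Rightarrow> real) \<Rightarrow> 'a filter \<Rightarrow> bool" where
  "cauchy_filter A \<Lambda> p F \<longleftrightarrow> F \<noteq> bot \<and> F \<le> principal (carrier A) \<and>
     (\<forall>\<alpha>\<in>\<Lambda>. \<forall>e>0. \<exists>S. eventually (\<lambda>x. x \<in> S) F \<and> S \<subseteq> carrier A \<and>
        (\<forall>x\<in>S. \<forall>y\<in>S. p \<alpha> (x \<ominus>\<^bsub>A\<^esub> y) < e))"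

definition seminorm_complete ::
    "'a star_algebra \<Rightarrow> 'i set \<Rightarrow> ('i \<Rightarrow> 'a \<Rightarrow> real) \<Rightarrow> bool" where
  "seminorm_complete A \<Lambda> p \<longleftrightarrow>
     (\<forall>F. cauchy_filter A \<Lambda> p F \<longrightarrow> (\<exists>l. limitin (seminorm_topology A \<Lambda> p) (\<lambda>x. x) l F))"

definition locally_cstar_algebra ::
    "'a star_algebra \<Rightarrow> 'i set \<Rightarrow> 'i rel \<Rightarrow> ('i \<Rightarrow> 'a \<Rightarrow> real) \<Rightarrow> bool" where
  "locally_cstar_algebra A \<Lambda> r p \<longleftrightarrow>
     complex_star_algebra A \<and> directed_poset \<Lambda> r \<and>
     (\<forall>\<alpha>\<in>\<Lambda>. cstar_seminorm A (p \<alpha>)) \<and> upward_filtered A r p \<and>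
     Hausdorff_space (seminorm_topology A \<Lambda> p) \<and> seminorm_complete A \<Lambda> p"


section \<open>Quotients by the kernel of a seminorm\<close>

definition null_ideal :: "'a star_algebra \<Rightarrow> ('a \<Rightarrow> real) \<Rightarrow> 'a set" where
  "null_ideal A p = {a \<in> carrier A. p a = 0}"

text \<open>The ring part is the library's factor ring. Scalar multiplication and involution are
  defined on cosets in the same way as its multiplication: the union runs over all
  representatives of the coset, all of which give the same result.\<close>

definition quot_algebra :: "'a star_algebra \<Rightarrow> ('a \<Rightarrow> real) \<Rightarrow> 'a set star_algebra" where
  "quot_algebra A p = (let I = null_ideal A p; Q = A Quot I in
     \<lparr>carrier = carrier Q, mult = mult Q, one = one Q, zero = zero Q, add = add Q,
      smult = (\<lambda>c X. \<Union>x\<in>X. I +>\<^bsub>A\<^esub> (c \<odot>\<^bsub>A\<^esub> x)),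
      invol = (\<lambda>X. \<Union>x\<in>X. I +>\<^bsub>A\<^esub> invol A x)\<rparr>)"

definition quot_map :: "'a star_algebra \<Rightarrow> ('a \<Rightarrow> real) \<Rightarrow> 'a \<Rightarrow> 'a set" where
  "quot_map A p = (\<lambda>a\<in>carrier A. null_ideal A p +>\<^bsub>A\<^esub> a)"

lemma quot_map_surj: "quot_map A p ` carrier A = carrier (quot_algebra A p)"
  unfolding quot_map_def quot_algebra_def Let_def FactRing_def A_RCOSETS_def'
  by (simp add: image_def a_r_coset_def') blast


section \<open>Character spaces\<close>

text \<open>Functionals are extensional functions: the value outside the carrier is
  \<^term>\<open>undefined\<close>, so that equality of functionals is equality on the carrier.\<close>

definition characters :: "'a star_algebra \<Rightarrow> ('a \<Rightarrow> complex) set" where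
  "characters B = {\<phi> \<in> extensional (carrier B).
     (\<forall>x\<in>carrier B. \<forall>y\<in>carrier B. \<phi> (x \<oplus>\<^bsub>B\<^esub> y) = \<phi> x + \<phi> y) \<and>
     (\<forall>c. \<forall>x\<in>carrier B. \<phi> (c \<odot>\<^bsub>B\<^esub> x) = c * \<phi> x) \<and>
     (\<forall>x\<in>carrier B. \<forall>y\<in>carrier B. \<phi> (x \<otimes>\<^bsub>B\<^esub> y) = \<phi> x * \<phi> y) \<and>
     (\<exists>x\<in>carrier B. \<phi> x \<noteq> 0)}"

text \<open>The weak-\<open>*\<close> topology is the coarsest one making all evaluations \<open>\<phi> \<mapsto> \<phi> x\<close> continuous,
  i.e. the one inherited from the product topology.\<close>

definition weak_star_topology :: "'a star_algebra \<Rightarrow> ('a \<Rightarrow> complex) topology" where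
  "weak_star_topology B =
     subtopology (product_topology (\<lambda>_. euclidean) (carrier B)) (characters B)"

lemma topspace_weak_star_topology [simp]:
  "topspace (weak_star_topology B) = characters B"
  by (auto simp: weak_star_topology_def characters_def PiE_def)

definition pullback_map ::
    "'a star_algebra \<Rightarrow> ('a \<Rightarrow> real) \<Rightarrow> ('a set \<Rightarrow> complex) \<Rightarrow> 'a \<Rightarrow> complex" where
  "pullback_map A p \<phi> = compose (carrier A) \<phi> (quot_map A p)"

lemma inj_on_pullback_map: "inj_on (pullback_map A p) (characters (quot_algebra A p))"
proof (rule inj_onI)
  fix \<phi> \<psi> assume *: "\<phi> \<in> characters (quot_algebra A p)" "\<psi> \<in> characters (quot_algebra A p)"
    "pullback_map A p \<phi> = pullback_map A p \<psi>"
  show "\<phi> = \<psi>"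
  proof (rule extensionalityI)
    fix X assume "X \<in> carrier (quot_algebra A p)"
    then obtain a where "a \<in> carrier A" "X = quot_map A p a"
      by (auto simp flip: quot_map_surj)
    then show "\<phi> X = \<psi> X"
      using fun_cong[OF *(3), of a] by (simp add: pullback_map_def compose_def)
  qed (use * in \<open>auto simp: characters_def\<close>)
qed

definition Z_set :: "'a star_algebra \<Rightarrow> ('a \<Rightarrow> real) \<Rightarrow> ('a \<Rightarrow> complex) set" where
  "Z_set A p = pullback_map A p ` characters (quot_algebra A p)"

definition Z_topology :: "'a star_algebra \<Rightarrow> ('a \<Rightarrow> real) \<Rightarrow> ('a \<Rightarrow> complex) topology" where
  "Z_topology A p = topology (\<lambda>S. \<exists>V. openin (weak_star_topology (quot_algebra A p)) V \<and>
     S = pullback_map A p ` V)"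

lemma openin_Z_topology:
  "openin (Z_topology A p) S \<longleftrightarrow>
     (\<exists>V. openin (weak_star_topology (quot_algebra A p)) V \<and> S = pullback_map A p ` V)"
proof -
  let ?W = "weak_star_topology (quot_algebra A p)"
  let ?P = "\<lambda>S. \<exists>V. openin ?W V \<and> S = pullback_map A p ` V"
  have "istopology ?P"
    unfolding istopology_def
  proof (intro conjI allI impI)
    fix S T assume "?P S" "?P T"
    then obtain V V' where V: "openin ?W V" "S = pullback_map A p ` V"
        "openin ?W V'" "T = pullback_map A p ` V'"
      by blast
    then have "V \<subseteq> characters (quot_algebra A p)" "V' \<subseteq> characters (quot_algebra A p)"
      using openin_subset[of ?W] by simp_all
    then have "S \<inter> T = pullback_map A p ` (V \<inter> V')"
      unfolding V(2,4) by (rule inj_on_image_Int[OF inj_on_pullback_map, symmetric])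
    moreover have "openin ?W (V \<inter> V')" using V by (intro openin_Int)
    ultimately show "?P (S \<inter> T)" by (intro exI conjI)
  next
    fix K assume "\<forall>S\<in>K. ?P S"
    then obtain V where V: "\<And>S. S \<in> K \<Longrightarrow> openin ?W (V S) \<and> S = pullback_map A p ` V S"
      by metis
    then have "\<Union>K = (\<Union>S\<in>K. pullback_map A p ` V S)" by auto
    then have "\<Union>K = pullback_map A p ` (\<Union>S\<in>K. V S)" by (simp only: image_UN)
    moreover have "openin ?W (\<Union>S\<in>K. V S)" using V by (intro openin_Union) blast
    ultimately show "?P (\<Union>K)" by (intro exI conjI)
  qed
  then show ?thesis by (simp add: Z_topology_def topology_inverse')
qed

lemma topspace_Z_topology [simp]: "topspace (Z_topology A p) = Z_set A p"
proof
  show "topspace (Z_topology A p) \<subseteq> Z_set A p"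
  proof -
    have "openin (Z_topology A p) (topspace (Z_topology A p))" by simp
    then obtain V where V: "openin (weak_star_topology (quot_algebra A p)) V"
        "topspace (Z_topology A p) = pullback_map A p ` V"
      unfolding openin_Z_topology by blast
    show ?thesis
      using openin_subset[OF V(1)] unfolding V(2) Z_set_def topspace_weak_star_topology
      by (rule image_mono)
  qed
  have "openin (Z_topology A p) (Z_set A p)"
    using openin_topspace[of "weak_star_topology (quot_algebra A p)"]
    by (auto simp: openin_Z_topology Z_set_def)
  then show "Z_set A p \<subseteq> topspace (Z_topology A p)" by (rule openin_subset)
qed

definition character_space ::
    "'a star_algebra \<Rightarrow> 'i set \<Rightarrow> ('i \<Rightarrow> 'a \<Rightarrow> real) \<Rightarrow> ('a \<Rightarrow> complex) set" where
  "character_space A \<Lambda> p = (\<Union>\<alpha>\<in>\<Lambda>. Z_set A (p \<alpha>))"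

definition character_topology ::
    "'a star_algebra \<Rightarrow> 'i set \<Rightarrow> ('i \<Rightarrow> 'a \<Rightarrow> real) \<Rightarrow> ('a \<Rightarrow> complex) topology" where
  "character_topology A \<Lambda> p = topology (\<lambda>S. S \<subseteq> character_space A \<Lambda> p \<and>
     (\<forall>\<alpha>\<in>\<Lambda>. openin (Z_topology A (p \<alpha>)) (S \<inter> Z_set A (p \<alpha>))))"

lemma openin_character_topology:
  "openin (character_topology A \<Lambda> p) S \<longleftrightarrow> S \<subseteq> character_space A \<Lambda> p \<and>
     (\<forall>\<alpha>\<in>\<Lambda>. openin (Z_topology A (p \<alpha>)) (S \<inter> Z_set A (p \<alpha>)))"
proof -
  let ?op = "\<lambda>\<alpha> S. openin (Z_topology A (p \<alpha>)) (S \<inter> Z_set A (p \<alpha>))"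
  have Int: "?op \<alpha> (S \<inter> T)" if "?op \<alpha> S" "?op \<alpha> T" for \<alpha> S T
    using openin_Int[OF that] by (simp add: Int_ac)
  have Un: "?op \<alpha> (\<Union>K)" if "\<forall>S\<in>K. ?op \<alpha> S" for \<alpha> K
  proof -
    have "openin (Z_topology A (p \<alpha>)) (\<Union>S\<in>K. S \<inter> Z_set A (p \<alpha>))"
      using that by (intro openin_Union) blast
    then show ?thesis by (simp only: Int_Union2)
  qed
  have "istopology (\<lambda>S. S \<subseteq> character_space A \<Lambda> p \<and> (\<forall>\<alpha>\<in>\<Lambda>. ?op \<alpha> S))"
    unfolding istopology_def
  proof (rule conjI; intro allI impI)
    fix S T assume "S \<subseteq> character_space A \<Lambda> p \<and> (\<forall>\<alpha>\<in>\<Lambda>. ?op \<alpha> S)"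
      and "T \<subseteq> character_space A \<Lambda> p \<and> (\<forall>\<alpha>\<in>\<Lambda>. ?op \<alpha> T)"
    then show "S \<inter> T \<subseteq> character_space A \<Lambda> p \<and> (\<forall>\<alpha>\<in>\<Lambda>. ?op \<alpha> (S \<inter> T))"
      by (metis Int le_infI1)
  next
    fix K assume K: "\<forall>S\<in>K. S \<subseteq> character_space A \<Lambda> p \<and> (\<forall>\<alpha>\<in>\<Lambda>. ?op \<alpha> S)"
    then have "\<Union>K \<subseteq> character_space A \<Lambda> p" by (intro Union_least) simp
    moreover have "\<forall>\<alpha>\<in>\<Lambda>. ?op \<alpha> (\<Union>K)" using K by (intro ballI Un) simp
    ultimately show "\<Union>K \<subseteq> character_space A \<Lambda> p \<and> (\<forall>\<alpha>\<in>\<Lambda>. ?op \<alpha> (\<Union>K))" ..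
  qed
  then show ?thesis by (simp add: character_topology_def topology_inverse')
qed

lemma topspace_character_topology [simp]:
  "topspace (character_topology A \<Lambda> p) = character_space A \<Lambda> p"
proof
  show "topspace (character_topology A \<Lambda> p) \<subseteq> character_space A \<Lambda> p"
    using openin_topspace[of "character_topology A \<Lambda> p"] by (simp only: openin_character_topology)
  have "character_space A \<Lambda> p \<inter> Z_set A (p \<alpha>) = topspace (Z_topology A (p \<alpha>))"
    if "\<alpha> \<in> \<Lambda>" for \<alpha>
    using that by (auto simp: character_space_def)
  then have "openin (character_topology A \<Lambda> p) (character_space A \<Lambda> p)"
    unfolding openin_character_topology by (metis openin_topspace subset_refl)
  then show "character_space A \<Lambda> p \<subseteq> topspace (character_topology A \<Lambda> p)"
    by (rule openin_subset)
qed


section \<open>Algebras of continuous functions\<close>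

definition cont_algebra :: "'x topology \<Rightarrow> ('x \<Rightarrow> complex) star_algebra" where
  "cont_algebra X =
     \<lparr>carrier = {f \<in> extensional (topspace X). continuous_map X euclidean f},
      mult = (\<lambda>f g. \<lambda>x\<in>topspace X. f x * g x),
      one = (\<lambda>x\<in>topspace X. 1),
      zero = (\<lambda>x\<in>topspace X. 0),
      add = (\<lambda>f g. \<lambda>x\<in>topspace X. f x + g x),
      smult = (\<lambda>c f. \<lambda>x\<in>topspace X. c * f x),
      invol = (\<lambda>f. \<lambda>x\<in>topspace X. cnj (f x))\<rparr>"

text \<open>Only applied to continuous functions on nonempty compact spaces, where the supremum
  is that of a nonempty bounded set of reals.\<close>

definition sup_norm :: "'x topology \<Rightarrow> ('x \<Rightarrow> complex) \<Rightarrow> real" where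
  "sup_norm X f = (SUP x\<in>topspace X. cmod (f x))"

definition xi_map :: "'a star_algebra \<Rightarrow> ('a \<Rightarrow> real) \<Rightarrow>
    (('a \<Rightarrow> complex) \<Rightarrow> complex) \<Rightarrow> ('a set \<Rightarrow> complex) \<Rightarrow> complex" where
  "xi_map A p f = compose (characters (quot_algebra A p)) f (pullback_map A p)"

definition q_seminorm ::
    "'a star_algebra \<Rightarrow> ('a \<Rightarrow> real) \<Rightarrow> (('a \<Rightarrow> complex) \<Rightarrow> complex) \<Rightarrow> real" where
  "q_seminorm A p f = sup_norm (weak_star_topology (quot_algebra A p)) (xi_map A p f)"


section \<open>The Gelfand map\<close>

definition coherent_representation :: "'a star_algebra \<Rightarrow> 'i set \<Rightarrow> ('i \<Rightarrow> 'a \<Rightarrow> real) \<Rightarrow>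
    ('a \<Rightarrow> ('a \<Rightarrow> complex) \<Rightarrow> complex) \<Rightarrow> bool" where
  "coherent_representation A \<Lambda> p \<Gamma> \<longleftrightarrow>
     \<Gamma> \<in> star_hom A (cont_algebra (character_topology A \<Lambda> p)) \<and>
     (\<exists>G. \<forall>\<alpha>\<in>\<Lambda>.
        G \<alpha> \<in> star_hom (quot_algebra A (p \<alpha>))
                (cont_algebra (weak_star_topology (quot_algebra A (p \<alpha>)))) \<and>
        (\<forall>a\<in>carrier A. xi_map A (p \<alpha>) (\<Gamma> a) = G \<alpha> (quot_map A (p \<alpha>) a)))"

definition local_isometric :: "'a star_algebra \<Rightarrow> 'i set \<Rightarrow> ('i \<Rightarrow> 'a \<Rightarrow> real) \<Rightarrow>
    ('a \<Rightarrow> ('a \<Rightarrow> complex) \<Rightarrow> complex) \<Rightarrow> bool" where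
  "local_isometric A \<Lambda> p \<Gamma> \<longleftrightarrow>
     (\<forall>a\<in>carrier A. \<forall>\<alpha>\<in>\<Lambda>. q_seminorm A (p \<alpha>) (\<Gamma> a) = p \<alpha> a)"

text \<open>The value at a point \<open>\<psi>\<close> of the character space is \<open>\<phi> (\<pi>\<^sub>\<alpha> a)\<close> for any representation
  \<open>\<psi> = \<phi> \<circ> \<pi>\<^sub>\<alpha>\<close>; it does not depend on the representation.\<close>

definition gelfand_map :: "'a star_algebra \<Rightarrow> 'i set \<Rightarrow> ('i \<Rightarrow> 'a \<Rightarrow> real) \<Rightarrow>
    'a \<Rightarrow> ('a \<Rightarrow> complex) \<Rightarrow> complex" where
  "gelfand_map A \<Lambda> p = (\<lambda>a\<in>carrier A. \<lambda>\<psi>\<in>character_space A \<Lambda> p.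
     THE z. \<exists>\<alpha>\<in>\<Lambda>. \<exists>\<phi>\<in>characters (quot_algebra A (p \<alpha>)).
       \<psi> = pullback_map A (p \<alpha>) \<phi> \<and> z = \<phi> (quot_map A (p \<alpha>) a))"

end

theory Submission
  imports Defs
begin

text \<open>The proof avoids completing the quotients \<open>A\<^sub>\<alpha>\<close>. For a C*-seminorm \<open>p\<close> and an element
  \<open>x\<close> with \<open>p x = 1\<close>, the limit of \<open>p (x\<^sup>n y)\<close> is a C*-seminorm below \<open>p\<close> for which \<open>x\<close> is
  multiplicative; it corresponds to the supremum over the set where \<open>\<bar>x\<bar>\<close> is maximal.
  Hence a C*-seminorm that is minimal among those below \<open>p\<close> with a given value at \<open>a\<close> is
  multiplicative, and by Mazur's argument it is the modulus of a character. This gives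
  a character bounded by \<open>p\<close> that attains \<open>p a\<close>, without any completeness.

  Conversely, let \<open>\<phi>\<close> be a character that vanishes where \<open>p\<^sub>\<alpha>\<close> does. Completeness of \<open>A\<close>
  gives a continuous functional calculus for self-adjoint \<open>h\<close>. If \<open>\<phi> h\<close> were not in
  \<open>[- p\<^sub>\<alpha> h, p\<^sub>\<alpha> h]\<close>, then \<open>h - \<phi> h\<close> would be invertible modulo the kernel of \<open>p\<^sub>\<alpha>\<close>, which is
  impossible. So \<open>\<phi>\<close> is hermitian and bounded by \<open>p\<^sub>\<alpha>\<close>.\<close>

section \<open>C*-seminorms on commutative \<open>*\<close>-algebras\<close>

locale comm_star_algebra = complex_star_algebra A + cring A
  for A :: "'a star_algebra" (structure)
begin

lemma smult_in_carrier [simp, intro]: "x \<in> carrier A \<Longrightarrow> c \<odot> x \<in> carrier A"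
  using smult_closed[of c x] by (simp add: complex_scalars_def)

lemma smult_add_left: "x \<in> carrier A \<Longrightarrow> (c + d) \<odot> x = c \<odot> x \<oplus> d \<odot> x"
  using smult_l_distr[of c d x] by (simp add: complex_scalars_def)

lemma smult_smult: "x \<in> carrier A \<Longrightarrow> (c * d) \<odot> x = c \<odot> (d \<odot> x)"
  using smult_assoc1[of c d x] by (simp add: complex_scalars_def)

lemma one_smult [simp]: "x \<in> carrier A \<Longrightarrow> 1 \<odot> x = x"
  using smult_one[of x] by (simp add: complex_scalars_def)

declare invol_closed [simp, intro]

abbreviation scal (\<open>\<iota>\<close>) where "\<iota> c \<equiv> c \<odot> \<one>"

lemma smult_eq_scal: "x \<in> carrier A \<Longrightarrow> c \<odot> x = \<iota> c \<otimes> x"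
  by (simp add: smult_mult_left)

lemma scal_add: "\<iota> (c + d) = \<iota> c \<oplus> \<iota> d" by (simp add: smult_add_left)

lemma scal_mult: "\<iota> (c * d) = \<iota> c \<otimes> \<iota> d" by (simp add: smult_smult smult_eq_scal[symmetric])

lemma scal_zero: "\<iota> 0 = \<zero>"
  using scal_add[of 0 0] by simp

lemma scal_uminus: "\<iota> (- c) = \<ominus> \<iota> c"
  using scal_add[of c "-c"] by (metis add.inv_equality add.m_comm ab_group_add_class.ab_left_minus
    one_closed scal_zero smult_in_carrier add.commute)

lemma sq_diff_sq: "\<lbrakk>k \<in> carrier A; w \<in> carrier A\<rbrakk> \<Longrightarrow> k \<otimes> k \<ominus> w \<otimes> w = (k \<ominus> w) \<otimes> (k \<oplus> w)"
  by algebra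

lemma sq_minus_scal: "k \<in> carrier A \<Longrightarrow> k \<otimes> k \<ominus> \<iota> (w*w) = (k \<ominus> \<iota> w) \<otimes> (k \<oplus> \<iota> w)"
  unfolding scal_mult by (simp add: sq_diff_sq)

lemma invol_one: "invol A \<one> = \<one>"
  by (metis invol_closed invol_invol invol_mult l_one one_closed)

lemma invol_scal: "invol A (\<iota> c) = \<iota> (cnj c)"
  by (simp add: invol_smult invol_one)

lemma uminus_eq_smult: "x \<in> carrier A \<Longrightarrow> \<ominus> x = - 1 \<odot> x"
  using smult_eq_scal[of x "- 1"] by (simp add: scal_uminus l_minus)

lemma scal_diff: "\<iota> (c - d) = \<iota> c \<ominus> \<iota> d"
  using scal_add[of c "- d"] by (simp add: scal_uminus a_minus_def)

lemma minus_scal_add: "x \<in> carrier A \<Longrightarrow> x \<ominus> \<iota> (c + d) = x \<ominus> \<iota> c \<ominus> \<iota> d"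
  by (simp add: scal_add a_minus_def minus_add a_assoc)

lemma minus_scal_uminus: "x \<in> carrier A \<Longrightarrow> x \<ominus> \<iota> (- c) = x \<oplus> \<iota> c"
  by (simp add: scal_uminus a_minus_def)

lemma diff_of_diffs:
  "\<lbrakk>x \<in> carrier A; y \<in> carrier A; z \<in> carrier A\<rbrakk> \<Longrightarrow> (x \<ominus> y) \<ominus> (x \<ominus> z) = z \<ominus> y"
  by algebra

lemma add_diff_add:
  "\<lbrakk>x \<in> carrier A; y \<in> carrier A; a \<in> carrier A; b \<in> carrier A\<rbrakk> \<Longrightarrow>
    (x \<oplus> y) \<ominus> (a \<oplus> b) = (x \<ominus> a) \<oplus> (y \<ominus> b)"
  by algebra

lemma mult_diff_mult:
  "\<lbrakk>x \<in> carrier A; y \<in> carrier A; a \<in> carrier A; b \<in> carrier A\<rbrakk> \<Longrightarrow>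
    (x \<otimes> y) \<ominus> (a \<otimes> b) = (x \<ominus> a) \<otimes> y \<oplus> a \<otimes> (y \<ominus> b)"
  by algebra

lemma smult_uminus: "x \<in> carrier A \<Longrightarrow> c \<odot> (\<ominus> x) = \<ominus> (c \<odot> x)"
  by (simp add: smult_eq_scal[of x] smult_eq_scal[of "\<ominus> x"] r_minus)

lemma smult_diff:
  "\<lbrakk>x \<in> carrier A; y \<in> carrier A\<rbrakk> \<Longrightarrow> c \<odot> (x \<ominus> y) = c \<odot> x \<ominus> c \<odot> y"
  using smult_r_distr[of c x "\<ominus> y"] by (simp add: complex_scalars_def a_minus_def smult_uminus)

lemma diff_split:
  "\<lbrakk>x \<in> carrier A; y \<in> carrier A; z \<in> carrier A\<rbrakk> \<Longrightarrow> x \<ominus> z = (x \<ominus> y) \<oplus> (y \<ominus> z)"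
  by algebra

end

section \<open>C*-seminorms on a commutative algebra: basic estimates and powers\<close>

locale cstar_seminormed = comm_star_algebra +
  fixes p :: "'a \<Rightarrow> real"
  assumes cstar: "cstar_seminorm A p"
begin

lemma
  assumes "x \<in> carrier A"
  shows p_nonneg [simp]: "0 \<le> p x"
    and p_smult: "p (c \<odot> x) = cmod c * p x"
    and p_invol: "p (invol A x) = p x"
    and p_star_self: "p (invol A x \<otimes> x) = (p x)\<^sup>2"
  using cstar assms by (auto simp: cstar_seminorm_def)

lemma
  assumes "x \<in> carrier A" "y \<in> carrier A"
  shows p_add: "p (x \<oplus> y) \<le> p x + p y"
    and p_mult: "p (x \<otimes> y) \<le> p x * p y"
  using cstar assms by (auto simp: cstar_seminorm_def)

lemma p_one [simp]: "p \<one> = 1"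
  using cstar by (auto simp: cstar_seminorm_def)

lemma p_scal [simp]: "p (\<iota> c) = cmod c"
  by (simp add: p_smult)

lemma p_zero [simp]: "p \<zero> = 0"
  using p_scal[of 0] by (simp add: scal_zero)

lemma p_uminus: "x \<in> carrier A \<Longrightarrow> p (\<ominus> x) = p x"
  by (simp add: uminus_eq_smult p_smult)

lemma p_diff: "\<lbrakk>x \<in> carrier A; y \<in> carrier A\<rbrakk> \<Longrightarrow> p (x \<ominus> y) \<le> p x + p y"
  using p_add[of x "\<ominus> y"] by (simp add: p_uminus a_minus_def)

lemma p_diff_ge: "\<lbrakk>x \<in> carrier A; y \<in> carrier A\<rbrakk> \<Longrightarrow> p x - p y \<le> p (x \<ominus> y)"
  using p_add[of "x \<ominus> y" y] by (simp add: a_minus_def a_assoc l_neg)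

lemma p_diff_commute: "\<lbrakk>x \<in> carrier A; y \<in> carrier A\<rbrakk> \<Longrightarrow> p (x \<ominus> y) = p (y \<ominus> x)"
  using p_uminus[of "x \<ominus> y"] by (simp add: minus_add a_minus_def a_comm)

text \<open>The C*-identity expresses both squares as the seminorm of a product of \<open>x\<close>,
  \<open>y\<close> and their adjoints; the two products differ only in the order of the
  factors.\<close>

lemma p_star_left:
  assumes "x \<in> carrier A" "y \<in> carrier A"
  shows "p (invol A x \<otimes> y) = p (x \<otimes> y)"
proof -
  have "(p (invol A x \<otimes> y))\<^sup>2 = (p (x \<otimes> y))\<^sup>2"
    using assms by (simp add: p_star_self[symmetric] invol_mult invol_invol m_ac)
  then show ?thesis using assms by simp
qed

text \<open>In a commutative algebra every element is normal, so the adjoint in the C*-identity can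
  be replaced by the element itself.\<close>

lemma p_sq: "x \<in> carrier A \<Longrightarrow> p (x \<otimes> x) = (p x)\<^sup>2"
  using p_star_left[of x x] by (simp add: p_star_self)

lemma p_pow_le_one:
  assumes "x \<in> carrier A" "p x = 1" shows "p (x [^] (n::nat)) \<le> 1"
proof (induction n)
  case (Suc n)
  then show ?case using p_mult[of "x [^] n" x] assms by simp
qed simp

text \<open>Repeated squaring settles the exponents \<open>2 ^ k\<close>. Any \<open>x [^] n\<close>
  divides such a power with a cofactor of seminorm at most 1, so its own seminorm cannot drop below
  1.\<close>

lemma p_pow_one:
  assumes x: "x \<in> carrier A" "p x = 1" shows "p (x [^] (n::nat)) = 1"
proof -
  have *: "p (x [^] ((2::nat) ^ k)) = 1" for k
  proof (induction k)
    case (Suc k)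
    have "x [^] ((2::nat) ^ Suc k) = x [^] ((2::nat) ^ k) \<otimes> x [^] ((2::nat) ^ k)"
      using x by (simp add: nat_pow_mult mult_2)
    then show ?case using x Suc by (simp add: p_sq)
  qed (use x in simp)
  have "n \<le> 2 ^ n" by (simp add: less_imp_le)
  then have "x [^] ((2::nat) ^ n) = x [^] n \<otimes> x [^] (2 ^ n - n)"
    using x by (simp add: nat_pow_mult)
  then have "1 \<le> p (x [^] n) * p (x [^] (2 ^ n - n))"
    using p_mult[of "x [^] n" "x [^] (2 ^ n - n)"] *[of n] x by simp
  also have "\<dots> \<le> p (x [^] n) * 1"
    using x by (intro mult_left_mono p_pow_le_one) auto
  finally show ?thesis using p_pow_le_one[OF x, of n] by simp
qed

section \<open>The limit of a C*-seminorm along the powers of an element\<close>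

definition peak :: "'a \<Rightarrow> 'a \<Rightarrow> real" where
  "peak x = (\<lambda>y\<in>carrier A. lim (\<lambda>n. p (x [^] (n::nat) \<otimes> y)))"

context
  fixes x assumes x: "x \<in> carrier A" "p x = 1"
begin

lemma peak_decseq: "y \<in> carrier A \<Longrightarrow> decseq (\<lambda>n. p (x [^] (n::nat) \<otimes> y))"
proof (rule decseq_SucI)
  fix n :: nat assume y: "y \<in> carrier A"
  have "p (x [^] Suc n \<otimes> y) = p (x \<otimes> (x [^] n \<otimes> y))" using x y by (simp add: m_ac)
  also have "\<dots> \<le> 1 * p (x [^] n \<otimes> y)" using p_mult[of x "x [^] n \<otimes> y"] x y by simp
  finally show "p (x [^] Suc n \<otimes> y) \<le> p (x [^] n \<otimes> y)" by simp
qed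

lemma peak_lim:
  assumes y: "y \<in> carrier A"
  shows "(\<lambda>n. p (x [^] (n::nat) \<otimes> y)) \<longlonglongrightarrow> peak x y"
proof -
  have "Bseq (\<lambda>n. p (x [^] (n::nat) \<otimes> y))"
  proof (rule BseqI')
    fix n
    show "norm (p (x [^] (n::nat) \<otimes> y)) \<le> p (x [^] (0::nat) \<otimes> y)"
      using decseqD[OF peak_decseq[OF y], of 0 n] x y by simp
  qed
  then have "convergent (\<lambda>n. p (x [^] (n::nat) \<otimes> y))"
    by (rule Bseq_monoseq_convergent) (rule decseq_imp_monoseq[OF peak_decseq[OF y]])
  then show ?thesis using y by (simp add: peak_def convergent_LIMSEQ_iff)
qed

text \<open>Even exponents form a subsequence with the same limit. They supply one power
  \<open>x [^] n\<close> for each of two factors, which is what submultiplicativity and the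
  C*-identity of \<open>peak x\<close> need.\<close>

lemma peak_lim2:
  assumes "y \<in> carrier A"
  shows "(\<lambda>n. p (x [^] (n::nat) \<otimes> (x [^] n \<otimes> y))) \<longlonglongrightarrow> peak x y"
proof -
  have "(\<lambda>n. p (x [^] (n + n) \<otimes> y)) \<longlonglongrightarrow> peak x y"
    using LIMSEQ_subseq_LIMSEQ[OF peak_lim[OF assms], of "\<lambda>n. n + n"]
    by (simp add: strict_mono_def o_def)
  then show ?thesis
    using x assms by (simp add: nat_pow_mult[symmetric] m_assoc)
qed

lemma peak_le: "y \<in> carrier A \<Longrightarrow> peak x y \<le> p y"
  using decseq_ge[OF peak_decseq peak_lim, of y 0] by simp

text \<open>Multiplying by \<open>x\<close> shifts the defining sequence by one index. Minimality
  will later transfer this invariance to the minimal seminorm.\<close>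

lemma peak_mult_left:
  assumes y: "y \<in> carrier A" shows "peak x (x \<otimes> y) = peak x y"
proof -
  have "(\<lambda>n. p (x [^] Suc n \<otimes> y)) \<longlonglongrightarrow> peak x y"
    by (rule LIMSEQ_Suc[OF peak_lim[OF y]])
  then have "(\<lambda>n. p (x [^] n \<otimes> (x \<otimes> y))) \<longlonglongrightarrow> peak x y"
    using x y by (simp add: m_assoc)
  then show ?thesis
    using LIMSEQ_unique peak_lim[of "x \<otimes> y"] x y by blast
qed

text \<open>Every law is inherited in the limit: the linear ones term by term, the multiplicative
  ones through the doubled powers of \<open>peak_lim2\<close>, and the value at the unit because all
  powers of \<open>x\<close> have seminorm 1.\<close>

lemma cstar_seminorm_peak: "cstar_seminorm A (peak x)"
  unfolding cstar_seminorm_def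
proof (intro conjI ballI allI)
  fix y assume y: "y \<in> carrier A"
  show "0 \<le> peak x y"
    using peak_lim[OF y] by (rule LIMSEQ_le_const) (use x y in auto)
  show "peak x (invol A y) = peak x y"
  proof -
    have "p (x [^] (n::nat) \<otimes> invol A y) = p (x [^] n \<otimes> y)" for n
      using p_star_left[of y "x [^] n"] x y by (simp add: m_comm)
    then show ?thesis using peak_lim[of y] peak_lim[of "invol A y"] y LIMSEQ_unique by simp
  qed
  show "peak x (c \<odot> y) = cmod c * peak x y" for c
  proof -
    have "(\<lambda>n. p (x [^] n \<otimes> (c \<odot> y))) = (\<lambda>n. cmod c * p (x [^] (n::nat) \<otimes> y))"
      using x y by (simp add: smult_mult_right p_smult)
    then show ?thesis
      using LIMSEQ_unique[OF peak_lim[of "c \<odot> y"]] tendsto_mult_left[OF peak_lim[OF y], of "cmod c"] y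
      by simp
  qed
  show "peak x (invol A y \<otimes> y) = (peak x y)\<^sup>2"
  proof -
    have "p (x [^] (n::nat) \<otimes> (x [^] n \<otimes> (invol A y \<otimes> y))) = (p (x [^] n \<otimes> y))\<^sup>2" for n
    proof -
      \<comment> \<open>One of the two powers may be replaced by its adjoint; the product then has
        the form adjoint of \<open>z\<close> times \<open>z\<close> with
        \<open>z = x [^] n \<otimes> y\<close>.\<close>
      have "p (x [^] n \<otimes> (x [^] n \<otimes> (invol A y \<otimes> y)))
          = p (invol A (x [^] n) \<otimes> (x [^] n \<otimes> (invol A y \<otimes> y)))"
        using x y by (intro p_star_left[symmetric]) auto
      also have "\<dots> = p (invol A (x [^] n \<otimes> y) \<otimes> (x [^] n \<otimes> y))"
        using x y by (simp add: invol_mult m_ac)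
      finally show ?thesis using x y by (simp add: p_star_self)
    qed
    then show ?thesis
      using LIMSEQ_unique[OF peak_lim2[of "invol A y \<otimes> y"]] tendsto_power[OF peak_lim[OF y], of 2] y
      by simp
  qed
next
  fix y z assume yz: "y \<in> carrier A" "z \<in> carrier A"
  show "peak x (y \<oplus> z) \<le> peak x y + peak x z"
  proof (rule LIMSEQ_le[OF peak_lim tendsto_add[OF peak_lim peak_lim]])
    have "p (x [^] (n::nat) \<otimes> (y \<oplus> z)) \<le> p (x [^] n \<otimes> y) + p (x [^] n \<otimes> z)" for n
      using x yz by (simp add: r_distr p_add)
    then show "\<exists>N. \<forall>n\<ge>N. p (x [^] (n::nat) \<otimes> (y \<oplus> z)) \<le> p (x [^] n \<otimes> y) + p (x [^] n \<otimes> z)"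
      by blast
  qed (use yz in auto)
  show "peak x (y \<otimes> z) \<le> peak x y * peak x z"
  proof (rule LIMSEQ_le[OF peak_lim2 tendsto_mult[OF peak_lim peak_lim]])
    have "p (x [^] (n::nat) \<otimes> (x [^] n \<otimes> (y \<otimes> z))) \<le> p (x [^] n \<otimes> y) * p (x [^] n \<otimes> z)" for n
    proof -
      have "x [^] n \<otimes> (x [^] n \<otimes> (y \<otimes> z)) = (x [^] n \<otimes> y) \<otimes> (x [^] n \<otimes> z)"
        using x yz by (simp add: m_ac)
      then show ?thesis using x yz by (simp add: p_mult)
    qed
    then show "\<exists>N. \<forall>n\<ge>N. p (x [^] (n::nat) \<otimes> (x [^] n \<otimes> (y \<otimes> z)))
        \<le> p (x [^] n \<otimes> y) * p (x [^] n \<otimes> z)"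
      by blast
  qed (use yz in auto)
next
  show "peak x \<one> = 1"
    using LIMSEQ_unique[OF peak_lim[of \<one>]] x by (simp add: p_pow_one)
qed

end

end

text \<open>The C*-seminorm laws compare only finitely many values at a time, so the infimum of a
  chain need only be approached on finite sets. The chain condition lets a single member be close to
  the infimum at several points at once.\<close>

lemma chain_Inf_sequence:
  fixes C :: "('a \<Rightarrow> real) set"
  assumes C: "C \<noteq> {}"
    and chain: "\<And>f g. \<lbrakk>f \<in> C; g \<in> C\<rbrakk> \<Longrightarrow> (\<forall>x\<in>X. f x \<le> g x) \<or> (\<forall>x\<in>X. g x \<le> f x)"
    and nonneg: "\<And>f x. \<lbrakk>f \<in> C; x \<in> X\<rbrakk> \<Longrightarrow> 0 \<le> f x"
    and F: "finite F" "F \<subseteq> X"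
  shows "\<exists>s. range s \<subseteq> C \<and> (\<forall>x\<in>F. (\<lambda>n. s n x) \<longlonglongrightarrow> (INF f\<in>C. f x))"
proof -
  have bdd: "bdd_below ((\<lambda>f. f x) ` C)" if "x \<in> X" for x
    using nonneg that by (intro bdd_belowI[of _ 0]) auto
  have ex: "\<exists>f\<in>C. \<forall>x\<in>F. f x < (INF f\<in>C. f x) + e" if e: "0 < e" for e
    using F
  proof (induction F rule: finite_induct)
    case empty
    then show ?case using C by auto
  next
    case (insert y F)
    then obtain f where f: "f \<in> C" "\<forall>x\<in>F. f x < (INF f\<in>C. f x) + e" by auto
    have "y \<in> X" using insert.prems by simp
    have "(INF f\<in>C. f y) < (INF f\<in>C. f y) + e" using e by simp
    then have "\<exists>g\<in>C. g y < (INF f\<in>C. f y) + e"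
      by (rule iffD1[OF cINF_less_iff[OF C bdd[OF \<open>y \<in> X\<close>]]])
    then obtain g where g: "g \<in> C" "g y < (INF f\<in>C. f y) + e" by blast
    \<comment> \<open>The smaller of the two members is close to the infimum at the old points and
      at the new one.\<close>
    from chain[OF f(1) g(1)] show ?case
    proof
      assume "\<forall>x\<in>X. f x \<le> g x"
      then have "f y < (INF f\<in>C. f y) + e" using g(2) \<open>y \<in> X\<close> by (meson le_less_trans)
      then show ?thesis using f by auto
    next
      assume "\<forall>x\<in>X. g x \<le> f x"
      then have "g x < (INF f\<in>C. f x) + e" if "x \<in> F" for x
        using f(2) insert.prems that by (intro le_less_trans[of "g x" "f x"]) auto
      then show ?thesis using g by auto
    qed
  qed
  have "\<forall>n. \<exists>f\<in>C. \<forall>x\<in>F. f x < (INF f\<in>C. f x) + inverse (real (Suc n))"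
    by (intro allI ex) simp
  then obtain s where s: "\<And>n. s n \<in> C"
      "\<And>n x. x \<in> F \<Longrightarrow> s n x < (INF f\<in>C. f x) + inverse (real (Suc n))"
    by metis
  have "(\<lambda>n. s n x) \<longlonglongrightarrow> (INF f\<in>C. f x)" if x: "x \<in> F" for x
  proof (rule tendsto_sandwich)
    show "\<forall>\<^sub>F n in sequentially. (INF f\<in>C. f x) \<le> s n x"
      using s(1) bdd x F by (intro always_eventually allI cINF_lower) auto
    show "\<forall>\<^sub>F n in sequentially. s n x \<le> (INF f\<in>C. f x) + inverse (real (Suc n))"
      using s(2)[OF x] by (intro always_eventually allI) (simp add: less_imp_le)
    show "(\<lambda>n. (INF f\<in>C. f x) + inverse (real (Suc n))) \<longlonglongrightarrow> (INF f\<in>C. f x)"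
      using LIMSEQ_inverse_real_of_nat_add .
  qed simp
  then show ?thesis using s(1) by blast
qed

section \<open>Pointwise limits of C*-seminorms\<close>

context comm_star_algebra
begin

lemma cstar_seminorm_cong:
  assumes "\<And>x. x \<in> carrier A \<Longrightarrow> p x = q x"
  shows "cstar_seminorm A p = cstar_seminorm A q"
  unfolding cstar_seminorm_def using assms by (simp cong: ball_cong)

text \<open>No law involves more than three values of \<open>q\<close>, so each can be checked along
  its own sequence, chosen for the arguments at hand.\<close>

lemma cstar_seminorm_limit:
  assumes q: "\<And>F. \<lbrakk>finite F; F \<subseteq> carrier A\<rbrakk> \<Longrightarrow>
      \<exists>s. (\<forall>n. cstar_seminorm A (s n)) \<and> (\<forall>x\<in>F. (\<lambda>n::nat. s n x) \<longlonglongrightarrow> q x)"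
  shows "cstar_seminorm A q"
proof -
  have unary: "\<exists>s. (\<forall>n. cstar_seminorm A (s n)) \<and> (\<lambda>n::nat. s n x) \<longlonglongrightarrow> q x \<and>
      (\<lambda>n::nat. s n y) \<longlonglongrightarrow> q y \<and> (\<lambda>n::nat. s n z) \<longlonglongrightarrow> q z"
    if "x \<in> carrier A" "y \<in> carrier A" "z \<in> carrier A" for x y z
    using q[of "{x, y, z}"] that by auto
  show ?thesis
    unfolding cstar_seminorm_def
  proof (intro conjI ballI allI)
    fix x assume x: "x \<in> carrier A"
    obtain s where s: "\<And>n. cstar_seminorm A (s n)" "(\<lambda>n::nat. s n x) \<longlonglongrightarrow> q x"
        "(\<lambda>n::nat. s n (invol A x)) \<longlonglongrightarrow> q (invol A x)"
        "(\<lambda>n::nat. s n (invol A x \<otimes> x)) \<longlonglongrightarrow> q (invol A x \<otimes> x)"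
      using unary[of x "invol A x" "invol A x \<otimes> x"] x by auto
    have s': "0 \<le> s n x" "s n (invol A x) = s n x" "s n (invol A x \<otimes> x) = (s n x)\<^sup>2" for n
      using s(1)[of n] x by (auto simp: cstar_seminorm_def)
    show "0 \<le> q x" by (rule LIMSEQ_le_const[OF s(2)]) (use s' in auto)
    show "q (invol A x) = q x" using LIMSEQ_unique[OF s(3)] s(2) s' by simp
    show "q (invol A x \<otimes> x) = (q x)\<^sup>2"
      using LIMSEQ_unique[OF s(4)] tendsto_power[OF s(2), of 2] s' by simp
    show "q (c \<odot> x) = cmod c * q x" for c
    proof -
      obtain s where s: "\<And>n. cstar_seminorm A (s n)" "(\<lambda>n::nat. s n x) \<longlonglongrightarrow> q x"
          "(\<lambda>n::nat. s n (c \<odot> x)) \<longlonglongrightarrow> q (c \<odot> x)"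
        using unary[of x "c \<odot> x" x] x by auto
      have "s n (c \<odot> x) = cmod c * s n x" for n
        using s(1)[of n] x by (auto simp: cstar_seminorm_def)
      then show ?thesis using LIMSEQ_unique[OF s(3)] tendsto_mult_left[OF s(2)] by simp
    qed
  next
    fix x y assume xy: "x \<in> carrier A" "y \<in> carrier A"
    obtain s where s: "\<And>n. cstar_seminorm A (s n)" "(\<lambda>n::nat. s n x) \<longlonglongrightarrow> q x"
        "(\<lambda>n::nat. s n y) \<longlonglongrightarrow> q y" "(\<lambda>n::nat. s n (x \<oplus> y)) \<longlonglongrightarrow> q (x \<oplus> y)"
      using unary[of x y "x \<oplus> y"] xy by auto
    show "q (x \<oplus> y) \<le> q x + q y"
      by (rule LIMSEQ_le[OF s(4) tendsto_add[OF s(2,3)]])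
        (use s(1) xy in \<open>auto simp: cstar_seminorm_def\<close>)
    obtain s where s: "\<And>n. cstar_seminorm A (s n)" "(\<lambda>n::nat. s n x) \<longlonglongrightarrow> q x"
        "(\<lambda>n::nat. s n y) \<longlonglongrightarrow> q y" "(\<lambda>n::nat. s n (x \<otimes> y)) \<longlonglongrightarrow> q (x \<otimes> y)"
      using unary[of x y "x \<otimes> y"] xy by auto
    show "q (x \<otimes> y) \<le> q x * q y"
      by (rule LIMSEQ_le[OF s(4) tendsto_mult[OF s(2,3)]])
        (use s(1) xy in \<open>auto simp: cstar_seminorm_def\<close>)
  next
    obtain s where s: "\<And>n. cstar_seminorm A (s n)" "(\<lambda>n::nat. s n \<one>) \<longlonglongrightarrow> q \<one>"
      using unary[of \<one> \<one> \<one>] by auto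
    then have "s n \<one> = 1" for n by (auto simp: cstar_seminorm_def)
    then show "q \<one> = 1" using LIMSEQ_unique[OF s(2)] by simp
  qed
qed

end

section \<open>Minimal C*-seminorms and their multiplicativity\<close>

context cstar_seminormed
begin

text \<open>Values outside the carrier are fixed so that comparison on the carrier is antisymmetric,
  as Zorn's lemma demands, and minimality yields equality of functions. \<open>peak\<close> is
  restricted to the carrier for the same purpose.\<close>

definition dominated :: "'a \<Rightarrow> ('a \<Rightarrow> real) set" where
  "dominated a = {q \<in> extensional (carrier A). cstar_seminorm A q \<and>
     (\<forall>x\<in>carrier A. q x \<le> p x) \<and> q a = p a}"

lemma minimal_dominated:
  assumes a: "a \<in> carrier A"
  obtains q where "q \<in> dominated a"
    "\<And>q'. \<lbrakk>q' \<in> dominated a; \<And>x. x \<in> carrier A \<Longrightarrow> q' x \<le> q x\<rbrakk> \<Longrightarrow> q' = q"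
proof -
  \<comment> \<open>The order is reversed, so that a maximal element is a minimal seminorm. A chain
    then needs a lower bound: \<open>p\<close> itself if it is empty, the pointwise infimum
    otherwise.\<close>
  let ?P = "\<lambda>f g. \<forall>x\<in>carrier A. g x \<le> (f x :: real)"
  have "\<exists>m\<in>dominated a. \<forall>q\<in>dominated a. ?P m q \<longrightarrow> q = m"
  proof (rule predicate_Zorn)
    show "partial_order_on (dominated a) (relation_of ?P (dominated a))"
    proof (rule partial_order_on_relation_ofI)
      show "f = g" if "f \<in> dominated a" "g \<in> dominated a" "?P f g" "?P g f" for f g
        using that by (intro extensionalityI[of f "carrier A"] antisym) (auto simp: dominated_def)
    next
      show "?P f h" if "?P f g" "?P g h" for f g h
        using that by (meson order_trans)
    qed simp
  next
    fix C assume C: "C \<in> Chains (relation_of ?P (dominated a))"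
    then have sub: "C \<subseteq> dominated a" by (rule Chains_relation_of)
    have chain: "?P f g \<or> ?P g f" if "f \<in> C" "g \<in> C" for f g
      using C that by (auto simp: Chains_def relation_of_def)
    show "\<exists>u\<in>dominated a. \<forall>f\<in>C. ?P f u"
    proof (cases "C = {}")
      case True
      have "restrict p (carrier A) \<in> dominated a"
        using cstar cstar_seminorm_cong[of "restrict p (carrier A)" p] a by (simp add: dominated_def)
      then show ?thesis using True by auto
    next
      case False
      let ?u = "\<lambda>x\<in>carrier A. INF f\<in>C. f x"
      have nonneg: "0 \<le> f x" if "f \<in> C" "x \<in> carrier A" for f x
        using that sub by (auto simp: dominated_def cstar_seminorm_def)
      have bdd: "bdd_below ((\<lambda>f. f x) ` C)" if "x \<in> carrier A" for x
        using nonneg that by (intro bdd_belowI[of _ 0]) auto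
      have le: "?P f ?u" if "f \<in> C" for f
        using that bdd by (auto intro: cINF_lower)
      have "\<exists>s. (\<forall>n. cstar_seminorm A (s n)) \<and> (\<forall>x\<in>F. (\<lambda>n::nat. s n x) \<longlonglongrightarrow> ?u x)"
        if F: "finite F" "F \<subseteq> carrier A" for F
      proof -
        obtain s where s: "range s \<subseteq> C" "\<forall>x\<in>F. (\<lambda>n. s n x) \<longlonglongrightarrow> (INF f\<in>C. f x)"
          using chain_Inf_sequence[OF False, of "carrier A" F] chain nonneg F by blast
        have "cstar_seminorm A (s n)" for n using s(1) sub by (auto simp: dominated_def)
        then show ?thesis using s(2) F by (intro exI[of _ s]) auto
      qed
      then have "cstar_seminorm A ?u" by (rule cstar_seminorm_limit)
      moreover have "\<forall>x\<in>carrier A. ?u x \<le> p x"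
      proof
        fix x assume x: "x \<in> carrier A"
        obtain f where "f \<in> C" using False by auto
        then show "?u x \<le> p x"
          using le[of f] sub x unfolding dominated_def by (blast intro: order_trans)
      qed
      moreover have "?u a = p a"
      proof -
        have "f a = p a" if "f \<in> C" for f using that sub by (auto simp: dominated_def)
        then have "(\<lambda>f. f a) ` C = {p a}" using False by auto
        then show ?thesis using a by simp
      qed
      ultimately have "?u \<in> dominated a" by (simp add: dominated_def)
      then show ?thesis using le by blast
    qed
  qed
  then show ?thesis using that by blast
qed

text \<open>A minimal \<open>q\<close> equals each of its peak seminorms that keeps the value 1 at
  \<open>a\<close>, and so inherits the invariance of that peak. This applies first to the peak at
  \<open>a\<close>, and with its help to the peak at every \<open>x\<close> with
  \<open>q x = 1\<close>.\<close>

lemma exists_multiplicative_seminorm: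
  assumes a: "a \<in> carrier A" "p a = 1"
  shows "\<exists>q. cstar_seminorm A q \<and> (\<forall>x\<in>carrier A. q x \<le> p x) \<and> q a = 1 \<and>
    (\<forall>x\<in>carrier A. \<forall>y\<in>carrier A. q (x \<otimes> y) = q x * q y)"
proof -
  obtain q where q: "q \<in> dominated a"
    and min: "\<And>q'. \<lbrakk>q' \<in> dominated a; \<And>x. x \<in> carrier A \<Longrightarrow> q' x \<le> q x\<rbrakk> \<Longrightarrow> q' = q"
    using minimal_dominated[OF a(1)] by blast
  have q': "cstar_seminorm A q" "\<And>x. x \<in> carrier A \<Longrightarrow> q x \<le> p x" "q a = 1"
    using q a by (auto simp: dominated_def)
  interpret q: cstar_seminormed A q by unfold_locales (rule q')
  have fix_peak: "q (x \<otimes> y) = q y"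
    if x: "x \<in> carrier A" "q x = 1" and peak: "q.peak x a = 1" and y: "y \<in> carrier A" for x y
  proof -
    have "q.peak x = q"
    proof (rule min)
      show "q.peak x \<in> dominated a"
        using q.cstar_seminorm_peak[OF x] q.peak_le[OF x] q'(2) peak a
        by (auto simp: dominated_def q.peak_def[of x] intro: order_trans)
      show "q.peak x y \<le> q y" if "y \<in> carrier A" for y
        using q.peak_le[OF x that] .
    qed
    then show ?thesis using q.peak_mult_left[OF x y] by simp
  qed
  \<comment> \<open>Invariance of the peak under its own element moves the value from
    \<open>a\<close> to the unit.\<close>
  have peak_a: "q.peak a a = 1"
  proof -
    have "q.peak a a = q.peak a (a \<otimes> \<one>)" using a by simp
    also have "\<dots> = q.peak a \<one>" using a q'(3) by (intro q.peak_mult_left) auto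
    also have "\<dots> = 1"
      using q.cstar_seminorm_peak[OF a(1) q'(3)] by (simp add: cstar_seminorm_def)
    finally show ?thesis .
  qed
  have peak: "q.peak x a = 1" if x: "x \<in> carrier A" "q x = 1" for x
  proof -
    have "q (x [^] (n::nat) \<otimes> a) = 1" for n
      using fix_peak[OF a(1) q'(3) peak_a, of "x [^] n"] x a q.p_pow_one[OF x, of n]
      by (simp add: m_comm)
    then show ?thesis using LIMSEQ_unique[OF q.peak_lim[OF x a(1)]] by simp
  qed
  have "q (x \<otimes> y) = q x * q y" if xy: "x \<in> carrier A" "y \<in> carrier A" for x y
  proof (cases "q x = 0")
    case True
    then have "q (x \<otimes> y) = 0"
      using q.p_mult[OF xy] q.p_nonneg[of "x \<otimes> y"] xy by (intro antisym) simp_all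
    then show ?thesis using True by simp
  next
    case False
    then have pos: "q x > 0" using q.p_nonneg[OF xy(1)] by simp
    \<comment> \<open>Rescaling by \<open>c\<close> brings \<open>x\<close> to seminorm 1, where
      \<open>fix_peak\<close> applies.\<close>
    define c where "c = complex_of_real (inverse (q x))"
    have "cmod c = inverse (q x)" using pos unfolding c_def by (simp only: norm_of_real abs_of_pos positive_imp_inverse_positive)
    then have c: "cmod c * q x = 1" using pos by simp
    have "q ((c \<odot> x) \<otimes> y) = q y"
      using fix_peak[of "c \<odot> x" y] peak[of "c \<odot> x"] xy c by (simp add: q.p_smult)
    then have "cmod c * q (x \<otimes> y) = q y" using xy by (simp add: smult_mult_left q.p_smult)
    then show ?thesis using c pos by (metis mult.assoc mult.commute mult_1)
  qed
  then show ?thesis using q' by blast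
qed

end

section \<open>Multiplicative seminorms and characters\<close>

locale multiplicative_cstar_seminormed = cstar_seminormed +
  assumes p_mult_eq: "\<lbrakk>x \<in> carrier A; y \<in> carrier A\<rbrakk> \<Longrightarrow> p (x \<otimes> y) = p x * p y"
begin

lemma p_pow: "x \<in> carrier A \<Longrightarrow> p (x [^] (n::nat)) = p x ^ n"
  by (induction n) (simp_all add: p_mult_eq)

lemma continuous_on_p_minus_scal:
  assumes h: "h \<in> carrier A"
  shows "continuous_on UNIV (\<lambda>z. p (h \<ominus> \<iota> z))"
proof -
  have "1-lipschitz_on UNIV (\<lambda>z. p (h \<ominus> \<iota> z))"
  proof (rule lipschitz_onI)
    fix z w
    have *: "p (h \<ominus> \<iota> z) - p (h \<ominus> \<iota> w) \<le> cmod (w - z)" for z w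
      using p_diff_ge[of "h \<ominus> \<iota> z" "h \<ominus> \<iota> w"] h
      by (simp add: diff_of_diffs scal_diff[symmetric])
    show "dist (p (h \<ominus> \<iota> z)) (p (h \<ominus> \<iota> w)) \<le> 1 * dist z w"
      using *[of z w] *[of w z] by (simp add: dist_norm norm_minus_commute abs_le_iff)
  qed simp
  then show ?thesis by (rule lipschitz_on_continuous_on)
qed

text \<open>Compactness gives a minimum over the disc of radius \<open>2 * p h\<close>. Outside it
  the reverse triangle inequality gives at least \<open>p h\<close>, which is already the value at
  0.\<close>

lemma p_minus_scal_attains_min:
  assumes h: "h \<in> carrier A"
  obtains z where "\<And>w. p (h \<ominus> \<iota> z) \<le> p (h \<ominus> \<iota> w)"
proof -
  have "\<exists>z\<in>cball 0 (2 * p h). \<forall>w\<in>cball 0 (2 * p h). p (h \<ominus> \<iota> z) \<le> p (h \<ominus> \<iota> w)"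
    using h p_nonneg[OF h]
    by (intro continuous_attains_inf continuous_on_subset[OF continuous_on_p_minus_scal]) (auto simp del: p_nonneg)
  then obtain z where "\<forall>w\<in>cball 0 (2 * p h). p (h \<ominus> \<iota> z) \<le> p (h \<ominus> \<iota> w)"
    by blast
  then have z: "p (h \<ominus> \<iota> z) \<le> p (h \<ominus> \<iota> w)" if "cmod w \<le> 2 * p h" for w
    using that by simp
  have "p (h \<ominus> \<iota> z) \<le> p (h \<ominus> \<iota> w)" for w
  proof (cases "cmod w \<le> 2 * p h")
    case False
    have "p (h \<ominus> \<iota> z) \<le> p (h \<ominus> \<iota> 0)" using z[of 0] p_nonneg[OF h] by simp
    also have "\<dots> = p h" using h by (simp add: scal_zero a_minus_def)
    also have "\<dots> \<le> cmod w - p h" using False by simp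
    also have "\<dots> \<le> p (h \<ominus> \<iota> w)"
      using p_diff_ge[of "\<iota> w" h] p_diff_commute[of h "\<iota> w"] h by simp
    finally show ?thesis .
  qed (rule z)
  then show ?thesis using that by blast
qed

text \<open>This is the \<open>2\<^sup>j\<close>-th root of unity form of the classical argument for Mazur's theorem.
  Factoring \<open>k\<^bsup>2m\<^esup> - w = (k\<^sup>m - v) (k\<^sup>m + v)\<close> with \<open>v\<^sup>2 = w\<close> avoids explicit roots of unity.\<close>

lemma minimum_locally_constant:
  assumes k: "k \<in> carrier A" and min: "\<And>w. p k \<le> p (k \<ominus> \<iota> w)" and d: "cmod d < p k"
  shows "p (k \<ominus> \<iota> d) = p k"
proof (rule antisym[OF _ min])
  define m where "m = p k"
  have m: "m > 0" unfolding m_def using norm_ge_zero d by (rule le_less_trans)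
  have double: "k [^] ((2::nat) ^ Suc j) = k [^] ((2::nat) ^ j) \<otimes> k [^] ((2::nat) ^ j)" for j
    using k by (simp add: nat_pow_mult mult_2)
  have factor: "p (k [^] ((2::nat) ^ Suc j) \<ominus> \<iota> (v * v))
      = p (k [^] ((2::nat) ^ j) \<ominus> \<iota> v) * p (k [^] ((2::nat) ^ j) \<ominus> \<iota> (- v))" for j v
    unfolding double using k by (simp only: sq_minus_scal nat_pow_closed minus_scal_uminus)
      (simp add: p_mult_eq)
  \<comment> \<open>Both factors of the split satisfy the bound for exponent \<open>2 ^ j\<close>,
    whatever square root of \<open>w\<close> occurs; hence the induction is over all
    \<open>w\<close>.\<close>
  have low: "m ^ (2 ^ j) \<le> p (k [^] ((2::nat) ^ j) \<ominus> \<iota> w)" for j w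
  proof (induction j arbitrary: w)
    case 0
    show ?case using min[of w] k by (simp add: m_def)
  next
    case (Suc j)
    have "m ^ (2 ^ Suc j) = m ^ (2 ^ j) * m ^ (2 ^ j)"
      by (simp add: power_add[symmetric] mult_2)
    also have "\<dots> \<le> p (k [^] ((2::nat) ^ j) \<ominus> \<iota> (csqrt w)) * p (k [^] ((2::nat) ^ j) \<ominus> \<iota> (- csqrt w))"
      using m k by (intro mult_mono Suc.IH) auto
    also have "\<dots> = p (k [^] ((2::nat) ^ Suc j) \<ominus> \<iota> (csqrt w * csqrt w))"
      by (rule factor[symmetric])
    also have "csqrt w * csqrt w = w" by (simp flip: power2_eq_square)
    finally show ?case .
  qed
  \<comment> \<open>Repeated splitting of the right-hand difference leaves
    \<open>k \<ominus> \<iota> d\<close> and cofactors that \<open>low\<close> bounds below,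
    together by the power of \<open>m\<close> with exponent \<open>2 ^ j - 1\<close>. The extra
    \<open>m\<close> on the right avoids the subtraction in the exponent.\<close>
  have up: "p (k \<ominus> \<iota> d) * m ^ (2 ^ j) \<le> p (k [^] ((2::nat) ^ j) \<ominus> \<iota> (d ^ (2 ^ j))) * m" for j
  proof (induction j)
    case 0
    show ?case using k by simp
  next
    case (Suc j)
    have "p (k \<ominus> \<iota> d) * m ^ (2 ^ Suc j) = (p (k \<ominus> \<iota> d) * m ^ (2 ^ j)) * m ^ (2 ^ j)"
      by (simp add: power_add[symmetric] mult_2)
    also have "\<dots> \<le> (p (k [^] ((2::nat) ^ j) \<ominus> \<iota> (d ^ (2 ^ j))) * m)
        * p (k [^] ((2::nat) ^ j) \<ominus> \<iota> (- (d ^ (2 ^ j))))"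
      using m k by (intro mult_mono Suc.IH low) auto
    also have "\<dots> = p (k [^] ((2::nat) ^ Suc j) \<ominus> \<iota> (d ^ (2 ^ j) * d ^ (2 ^ j))) * m"
      unfolding factor by (simp only: mult_ac)
    also have "d ^ (2 ^ j) * d ^ (2 ^ j) = d ^ (2 ^ Suc j)"
      by (simp add: power_add[symmetric] mult_2)
    finally show ?case .
  qed
  have "p (k \<ominus> \<iota> d) \<le> m * (1 + (cmod d / m) ^ (2 ^ j))" for j
  proof -
    have "p (k \<ominus> \<iota> d) * m ^ (2 ^ j) \<le> (m ^ (2 ^ j) + cmod d ^ (2 ^ j)) * m"
    proof (rule order_trans[OF up mult_right_mono])
      have "p (k [^] ((2::nat) ^ j) \<ominus> \<iota> (d ^ (2 ^ j))) \<le> p (k [^] ((2::nat) ^ j)) + p (\<iota> (d ^ (2 ^ j)))"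
        using k by (intro p_diff) auto
      also have "\<dots> = m ^ (2 ^ j) + cmod d ^ (2 ^ j)"
        unfolding p_pow[OF k] p_scal norm_power m_def ..
      finally show "p (k [^] ((2::nat) ^ j) \<ominus> \<iota> (d ^ (2 ^ j))) \<le> m ^ (2 ^ j) + cmod d ^ (2 ^ j)" .
    qed (use m in simp)
    then have "p (k \<ominus> \<iota> d) \<le> ((m ^ (2 ^ j) + cmod d ^ (2 ^ j)) * m) / m ^ (2 ^ j)"
      using m by (simp add: pos_le_divide_eq)
    also have "\<dots> = m * (1 + (cmod d / m) ^ (2 ^ j))"
      using m by (simp add: power_divide add_divide_distrib distrib_left distrib_right mult.commute)
    finally show ?thesis .
  qed
  \<comment> \<open>Since \<open>cmod d < m\<close>, the correction term vanishes along the
    exponents \<open>2 ^ j\<close>, a subsequence of all exponents.\<close>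
  moreover have "(\<lambda>j. m * (1 + (cmod d / m) ^ (2 ^ j))) \<longlonglongrightarrow> m * (1 + 0)"
  proof (intro tendsto_intros)
    have "strict_mono (\<lambda>j. (2::nat) ^ j)" by (simp add: strict_mono_def)
    moreover have "(\<lambda>n. (cmod d / m) ^ n) \<longlonglongrightarrow> 0"
      using m d by (intro LIMSEQ_power_zero) (simp add: m_def)
    ultimately have "((\<lambda>n. (cmod d / m) ^ n) \<circ> (\<lambda>j. 2 ^ j)) \<longlonglongrightarrow> 0"
      by (intro LIMSEQ_subseq_LIMSEQ)
    then show "(\<lambda>j. (cmod d / m) ^ (2 ^ j)) \<longlonglongrightarrow> 0"
      by (simp only: o_def)
  qed
  ultimately have "p (k \<ominus> \<iota> d) \<le> m * (1 + 0)"
    by (intro LIMSEQ_le_const) blast+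
  then show "p (k \<ominus> \<iota> d) \<le> p k" by (simp add: m_def)
qed

text \<open>Otherwise the minimum \<open>m\<close> of the distances to scalars is positive. Local
  constancy with radius \<open>m\<close> makes the set of minimisers open, continuity makes it
  closed, so it is the whole plane, against the growth of the distance for large scalars.\<close>

lemma exists_scalar:
  assumes h: "h \<in> carrier A"
  shows "\<exists>z. p (h \<ominus> \<iota> z) = 0"
proof (rule ccontr)
  assume no: "\<not> ?thesis"
  obtain z0 where z0: "\<And>w. p (h \<ominus> \<iota> z0) \<le> p (h \<ominus> \<iota> w)"
    using p_minus_scal_attains_min[OF h] by blast
  define m where "m = p (h \<ominus> \<iota> z0)"
  define Z where "Z = {z. p (h \<ominus> \<iota> z) = m}"
  have "m > 0" using no h p_nonneg[of "h \<ominus> \<iota> z0"] by (auto simp: m_def less_le)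
  have "open Z"
    unfolding open_dist
  proof
    fix z assume z: "z \<in> Z"
    have "w \<in> Z" if "dist w z < m" for w
    proof -
      have shift: "h \<ominus> \<iota> z \<ominus> \<iota> c = h \<ominus> \<iota> (z + c)" for c
        using h by (simp add: minus_scal_add)
      have "p (h \<ominus> \<iota> z \<ominus> \<iota> (w - z)) = p (h \<ominus> \<iota> z)"
        using h z z0 that by (intro minimum_locally_constant) (auto simp: shift Z_def m_def dist_norm)
      then show ?thesis using z by (simp add: shift Z_def)
    qed
    then show "\<exists>e>0. \<forall>y. dist y z < e \<longrightarrow> y \<in> Z" using \<open>m > 0\<close> by blast
  qed
  moreover have "closed Z"
    using continuous_closed_preimage_constant[OF continuous_on_p_minus_scal[OF h] closed_UNIV, of m]
    by (simp add: Z_def)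
  moreover have "z0 \<in> Z" by (simp add: Z_def m_def)
  ultimately have "Z = UNIV" using clopen by blast
  \<comment> \<open>This scalar is so large that the reverse triangle inequality forces a value of
    at least \<open>m + 1\<close>.\<close>
  then have "p (h \<ominus> \<iota> (of_real (p h + m + 1))) = m" by (auto simp: Z_def)
  moreover have "p h + m + 1 - p h \<le> p (h \<ominus> \<iota> (of_real (p h + m + 1)))"
  proof -
    have "cmod (of_real (p h + m + 1)) = p h + m + 1"
      unfolding norm_of_real using h \<open>m > 0\<close> by simp
    then show ?thesis
      using p_diff_ge[of "\<iota> (of_real (p h + m + 1))" h]
        p_diff_commute[of h "\<iota> (of_real (p h + m + 1))"] h by simp
  qed
  ultimately show False by simp
qed

lemma scalar_unique:
  assumes h: "h \<in> carrier A" and z: "p (h \<ominus> \<iota> z) = 0" and w: "p (h \<ominus> \<iota> w) = 0"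
  shows "z = w"
proof -
  have "cmod (w - z) = p ((h \<ominus> \<iota> z) \<ominus> (h \<ominus> \<iota> w))"
    using h by (simp add: diff_of_diffs scal_diff[symmetric])
  also have "\<dots> \<le> 0" using p_diff[of "h \<ominus> \<iota> z" "h \<ominus> \<iota> w"] h z w by simp
  finally show ?thesis by simp
qed

text \<open>The character sends \<open>x\<close> to the unique scalar that agrees with it modulo the
  kernel of \<open>p\<close>. By uniqueness, each algebraic law reduces to checking that the
  expected scalar is at distance 0.\<close>

lemma exists_character_eq:
  "\<exists>\<phi>\<in>characters A. \<forall>x\<in>carrier A. cmod (\<phi> x) = p x"
proof -
  obtain f where f: "\<And>x. x \<in> carrier A \<Longrightarrow> p (x \<ominus> \<iota> (f x)) = 0"
    using exists_scalar by metis
  have eq: "f x = z" if "x \<in> carrier A" "p (x \<ominus> \<iota> z) \<le> 0" for x z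
    using scalar_unique[OF that(1) f[OF that(1)]] that p_nonneg[of "x \<ominus> \<iota> z"] by (simp add: antisym)
  have norm: "cmod (f x) = p x" if x: "x \<in> carrier A" for x
    using p_diff_ge[of x "\<iota> (f x)"] p_diff_ge[of "\<iota> (f x)" x] f[OF x]
      p_diff_commute[of x "\<iota> (f x)"] x by simp
  have "restrict f (carrier A) \<in> characters A"
    unfolding characters_def
  proof (intro CollectI conjI ballI allI)
    fix x y assume xy: "x \<in> carrier A" "y \<in> carrier A"
    have "f (x \<oplus> y) = f x + f y"
    proof (rule eq)
      show "p (x \<oplus> y \<ominus> \<iota> (f x + f y)) \<le> 0"
        using p_add[of "x \<ominus> \<iota> (f x)" "y \<ominus> \<iota> (f y)"] f xy by (simp add: scal_add add_diff_add)
    qed (use xy in simp)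
    then show "restrict f (carrier A) (x \<oplus> y) = restrict f (carrier A) x + restrict f (carrier A) y"
      using xy by simp
    have "f (x \<otimes> y) = f x * f y"
    proof (rule eq)
      have "p (x \<otimes> y \<ominus> \<iota> (f x * f y)) \<le> p ((x \<ominus> \<iota> (f x)) \<otimes> y) + p (\<iota> (f x) \<otimes> (y \<ominus> \<iota> (f y)))"
        unfolding scal_mult using xy by (simp add: mult_diff_mult p_add)
      then show "p (x \<otimes> y \<ominus> \<iota> (f x * f y)) \<le> 0" using f xy by (simp add: p_mult_eq)
    qed (use xy in simp)
    then show "restrict f (carrier A) (x \<otimes> y) = restrict f (carrier A) x * restrict f (carrier A) y"
      using xy by simp
  next
    fix c x assume x: "x \<in> carrier A"
    have "f (c \<odot> x) = c * f x"
    proof (rule eq)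
      have "c \<odot> x \<ominus> \<iota> (c * f x) = c \<odot> (x \<ominus> \<iota> (f x))"
        using x by (simp add: smult_diff smult_smult)
      then show "p (c \<odot> x \<ominus> \<iota> (c * f x)) \<le> 0" using f[OF x] x by (simp add: p_smult)
    qed (use x in simp)
    then show "restrict f (carrier A) (c \<odot> x) = c * restrict f (carrier A) x" using x by simp
  next
    show "\<exists>x\<in>carrier A. restrict f (carrier A) x \<noteq> 0"
      using norm[of \<one>] by (intro bexI[of _ \<one>]) auto
  qed simp
  then show ?thesis using norm by (intro bexI[of _ "restrict f (carrier A)"]) auto
qed

end

text \<open>A stand-in for the characters of the quotient, phrased on \<open>A\<close> itself. The
  two are matched by \<open>pullback_bounded_character\<close> and
  \<open>bounded_character_pushforward\<close>.\<close>

definition bounded_characters :: "'a star_algebra \<Rightarrow> ('a \<Rightarrow> real) \<Rightarrow> ('a \<Rightarrow> complex) set" where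
  "bounded_characters A p = {\<phi> \<in> characters A. \<forall>x\<in>carrier A. cmod (\<phi> x) \<le> p x}"

context comm_star_algebra
begin

context
  fixes \<phi> assumes \<phi>: "\<phi> \<in> characters A"
begin

lemma
  assumes "x \<in> carrier A"
  shows character_smult: "\<phi> (c \<odot> x) = c * \<phi> x"
  using \<phi> assms by (auto simp: characters_def)

lemma
  assumes "x \<in> carrier A" "y \<in> carrier A"
  shows character_add: "\<phi> (x \<oplus> y) = \<phi> x + \<phi> y"
    and character_mult: "\<phi> (x \<otimes> y) = \<phi> x * \<phi> y"
  using \<phi> assms by (auto simp: characters_def)

lemma character_one: "\<phi> \<one> = 1"
proof -
  obtain x where "x \<in> carrier A" "\<phi> x \<noteq> 0" using \<phi> by (auto simp: characters_def)
  then show ?thesis using character_mult[of x \<one>] by simp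
qed

lemma character_scal: "\<phi> (\<iota> c) = c"
  by (simp add: character_smult character_one)

lemma character_uminus: "x \<in> carrier A \<Longrightarrow> \<phi> (\<ominus> x) = - \<phi> x"
  using character_add[of x "\<ominus> x"] character_scal[of 0]
  by (simp add: r_neg scal_zero eq_neg_iff_add_eq_0 add.commute)

lemma character_diff: "\<lbrakk>x \<in> carrier A; y \<in> carrier A\<rbrakk> \<Longrightarrow> \<phi> (x \<ominus> y) = \<phi> x - \<phi> y"
  by (simp add: a_minus_def character_add character_uminus)

end

end

section \<open>Bounded characters: attaining the seminorm, and reality on self-adjoint
  elements\<close>

context cstar_seminormed
begin

text \<open>After rescaling to seminorm 1, a multiplicative C*-seminorm below \<open>p\<close> with
  value 1 at the element is the modulus of a character; domination gives the bound.\<close>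

lemma exists_bounded_character:
  assumes a: "a \<in> carrier A"
  shows "\<exists>\<phi>\<in>bounded_characters A p. cmod (\<phi> a) = p a"
proof -
  have normalized: "\<exists>\<phi>\<in>bounded_characters A p. cmod (\<phi> b) = 1" if b: "b \<in> carrier A" "p b = 1" for b
  proof -
    obtain q where q: "cstar_seminorm A q" "\<forall>x\<in>carrier A. q x \<le> p x" "q b = 1"
        "\<forall>x\<in>carrier A. \<forall>y\<in>carrier A. q (x \<otimes> y) = q x * q y"
      using exists_multiplicative_seminorm[OF b] by blast
    interpret q: multiplicative_cstar_seminormed A q
      by unfold_locales (use q(1,4) in blast)+
    obtain \<phi> where "\<phi> \<in> characters A" "\<forall>x\<in>carrier A. cmod (\<phi> x) = q x"
      using q.exists_character_eq by blast
    then show ?thesis using q b by (intro bexI[of _ \<phi>]) (auto simp: bounded_characters_def)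
  qed
  show ?thesis
  proof (cases "p a = 0")
    case True
    \<comment> \<open>Every bounded character vanishes at \<open>a\<close> here; the unit, which has
      seminorm 1, supplies one.\<close>
    obtain \<phi> where "\<phi> \<in> bounded_characters A p" using normalized[of \<one>] by auto
    then show ?thesis using True a by (intro bexI[of _ \<phi>]) (auto simp: bounded_characters_def)
  next
    case False
    then have pos: "p a > 0" using p_nonneg[OF a] by simp
    define c where "c = complex_of_real (inverse (p a))"
    have "cmod c = inverse (p a)"
      unfolding c_def using pos by (simp only: norm_of_real abs_of_pos positive_imp_inverse_positive)
    then have c: "cmod c * p a = 1" using pos by simp
    obtain \<phi> where \<phi>: "\<phi> \<in> bounded_characters A p" "cmod (\<phi> (c \<odot> a)) = 1"
      using normalized[of "c \<odot> a"] a c by (auto simp: p_smult)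
    have "cmod c * cmod (\<phi> a) = 1"
      using \<phi> a by (simp add: bounded_characters_def character_smult norm_mult)
    then have "cmod (\<phi> a) = p a" using c by (metis mult.assoc mult.commute mult_1)
    then show ?thesis using \<phi>(1) by blast
  qed
qed

text \<open>Shifting \<open>h\<close> by an imaginary scalar of size \<open>t\<close> raises the
  bound on the squared seminorm by only \<open>t\<^sup>2\<close>, whereas the squared modulus of the
  value also gains \<open>2 * Im (\<phi> h) * t\<close>. A nonzero imaginary part would violate this
  for suitable \<open>t\<close>.\<close>

lemma bounded_character_self_adjoint:
  assumes \<phi>: "\<phi> \<in> bounded_characters A p" and h: "h \<in> carrier A" "invol A h = h"
  shows "\<phi> h = of_real (Re (\<phi> h))"
proof -
  have \<phi>': "\<phi> \<in> characters A" "\<And>x. x \<in> carrier A \<Longrightarrow> cmod (\<phi> x) \<le> p x"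
    using \<phi> by (auto simp: bounded_characters_def)
  have bound: "(Re (\<phi> h))\<^sup>2 + (Im (\<phi> h) + t)\<^sup>2 \<le> (p h)\<^sup>2 + t\<^sup>2" for t :: real
  proof -
    define u where "u = \<iota> (\<i> * of_real t)"
    have u: "u \<in> carrier A" by (simp add: u_def)
    have "invol A u = \<ominus> u" by (simp add: u_def invol_scal scal_uminus)
    then have "invol A (h \<oplus> u) = h \<ominus> u" using h u by (simp add: invol_add a_minus_def)
    then have "(p (h \<oplus> u))\<^sup>2 = p ((h \<ominus> u) \<otimes> (h \<oplus> u))"
      using p_star_self[of "h \<oplus> u"] h u by simp
    also have "\<dots> = p (h \<otimes> h \<ominus> u \<otimes> u)" using h u by (simp add: sq_diff_sq)
    also have "\<dots> \<le> p (h \<otimes> h) + p (u \<otimes> u)" using h u by (intro p_diff) auto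
    also have "\<dots> \<le> (p h)\<^sup>2 + (p u)\<^sup>2"
      using p_mult[of h h] p_mult[of u u] h u by (simp add: power2_eq_square)
    also have "p u = \<bar>t\<bar>" by (simp add: u_def norm_mult)
    finally have "(p (h \<oplus> u))\<^sup>2 \<le> (p h)\<^sup>2 + t\<^sup>2" by simp
    moreover have norm_le: "cmod (\<phi> h + \<i> * of_real t) \<le> p (h \<oplus> u)"
      using \<phi>'(2)[of "h \<oplus> u"] h u by (simp add: character_add[OF \<phi>'(1)] u_def character_scal[OF \<phi>'(1)])
    have "(cmod (\<phi> h + \<i> * of_real t))\<^sup>2 \<le> (p (h \<oplus> u))\<^sup>2"
      by (rule power_mono[OF norm_le norm_ge_zero])
    ultimately have "(cmod (\<phi> h + \<i> * of_real t))\<^sup>2 \<le> (p h)\<^sup>2 + t\<^sup>2" by linarith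
    then show ?thesis by (simp add: cmod_power2)
  qed
  have "Im (\<phi> h) = 0"
  proof (rule ccontr)
    assume y: "Im (\<phi> h) \<noteq> 0"
    have "(Im (\<phi> h))\<^sup>2 + 2 * Im (\<phi> h) * t \<le> (p h)\<^sup>2" for t
      using bound[of t] zero_le_power2[of "Re (\<phi> h)"] unfolding power2_sum by linarith
    \<comment> \<open>This \<open>t\<close> turns the linear term into
      \<open>2 * ((p h)\<^sup>2 + 1)\<close>, beyond the bound.\<close>
    from this[of "((p h)\<^sup>2 + 1) / Im (\<phi> h)"] y show False
      using zero_le_power2[of "Im (\<phi> h)"] zero_le_power2[of "p h"] by simp
  qed
  then show ?thesis by (simp add: complex_eq_iff)
qed

end

section \<open>Functional calculus\<close>

context comm_star_algebra
begin

text \<open>\<open>b\<close> is \<open>P\<close> evaluated at \<open>h\<close>, built along the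
  generation of \<open>P\<close>. It is described only through its values at characters, as these
  are all that the approximation uses.\<close>

lemma real_polynomial_calculus:
  assumes P: "real_polynomial_function P" and h: "h \<in> carrier A"
  shows "\<exists>b\<in>carrier A. \<forall>\<phi>\<in>characters A. \<phi> h = of_real (Re (\<phi> h)) \<longrightarrow>
    \<phi> b = of_real (P (Re (\<phi> h)))"
  using P
proof induction
  case (linear f)
  have f: "f x = f 1 * x" for x
    using linear_times_of_real linear bounded_linear.linear linear_cmul[of f x 1] by fastforce
  show ?case
  proof (intro bexI[of _ "of_real (f 1) \<odot> h"] ballI impI)
    fix \<phi> assume \<phi>: "\<phi> \<in> characters A" "\<phi> h = of_real (Re (\<phi> h))"
    have "\<phi> (of_real (f 1) \<odot> h) = of_real (f 1) * \<phi> h" by (rule character_smult[OF \<phi>(1) h])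
    also have "\<dots> = of_real (f 1 * Re (\<phi> h))" by (subst \<phi>(2)) simp
    finally show "\<phi> (of_real (f 1) \<odot> h) = of_real (f (Re (\<phi> h)))" by (simp only: f[of "Re (\<phi> h)"])
  qed (use h in simp)
next
  case (const c)
  show ?case
    by (intro bexI[of _ "\<iota> (of_real c)"]) (auto simp: character_scal)
next
  case (add f g)
  then obtain b c where "b \<in> carrier A" "c \<in> carrier A"
      "\<forall>\<phi>\<in>characters A. \<phi> h = of_real (Re (\<phi> h)) \<longrightarrow> \<phi> b = of_real (f (Re (\<phi> h)))"
      "\<forall>\<phi>\<in>characters A. \<phi> h = of_real (Re (\<phi> h)) \<longrightarrow> \<phi> c = of_real (g (Re (\<phi> h)))"
    by blast
  then show ?case
    by (intro bexI[of _ "b \<oplus> c"]) (auto simp: character_add)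
next
  case (mult f g)
  then obtain b c where "b \<in> carrier A" "c \<in> carrier A"
      "\<forall>\<phi>\<in>characters A. \<phi> h = of_real (Re (\<phi> h)) \<longrightarrow> \<phi> b = of_real (f (Re (\<phi> h)))"
      "\<forall>\<phi>\<in>characters A. \<phi> h = of_real (Re (\<phi> h)) \<longrightarrow> \<phi> c = of_real (g (Re (\<phi> h)))"
    by blast
  then show ?case
    by (intro bexI[of _ "b \<otimes> c"]) (auto simp: character_mult)
qed

end

context cstar_seminormed
begin

lemma bounded_character_in_interval:
  assumes \<phi>: "\<phi> \<in> bounded_characters A p" and h: "h \<in> carrier A"
  shows "Re (\<phi> h) \<in> {- p h .. p h}"
  using \<phi> h abs_Re_le_cmod[of "\<phi> h"] by (fastforce simp: bounded_characters_def abs_le_iff)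

text \<open>All bounded characters take real values at \<open>h\<close> in the one interval
  \<open>{- p h .. p h}\<close>, so Weierstrass approximation on it is uniform over them.\<close>

lemma approximate_calculus:
  fixes f :: "real \<Rightarrow> real"
  assumes f: "continuous_on UNIV f" and h: "h \<in> carrier A" "invol A h = h" and e: "0 < e"
  shows "\<exists>b\<in>carrier A. \<forall>\<phi>\<in>bounded_characters A p. cmod (\<phi> b - of_real (f (Re (\<phi> h)))) < e"
proof -
  obtain P where P: "real_polynomial_function P" "\<And>x. x \<in> {- p h .. p h} \<Longrightarrow> \<bar>f x - P x\<bar> < e"
    using Stone_Weierstrass_real_polynomial_function[OF compact_Icc
        continuous_on_subset[OF f subset_UNIV] e] by blast
  obtain b where b: "b \<in> carrier A"
      "\<forall>\<phi>\<in>characters A. \<phi> h = of_real (Re (\<phi> h)) \<longrightarrow> \<phi> b = of_real (P (Re (\<phi> h)))"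
    using real_polynomial_calculus[OF P(1) h(1)] by blast
  have "cmod (\<phi> b - of_real (f (Re (\<phi> h)))) < e" if \<phi>: "\<phi> \<in> bounded_characters A p" for \<phi>
  proof -
    have "\<phi> b = of_real (P (Re (\<phi> h)))"
      using b(2) \<phi> bounded_character_self_adjoint[OF \<phi> h] by (simp add: bounded_characters_def)
    then have "cmod (\<phi> b - of_real (f (Re (\<phi> h)))) = \<bar>f (Re (\<phi> h)) - P (Re (\<phi> h))\<bar>"
      unfolding abs_minus_commute[of "f _"] by (simp only: of_real_diff[symmetric] norm_of_real)
    then show ?thesis using P(2)[OF bounded_character_in_interval[OF \<phi> h(1)]] by simp
  qed
  then show ?thesis using b(1) by blast
qed

end

section \<open>Completeness and the continuous functional calculus\<close>

locale commutative_locally_cstar_algebra = comm_star_algebra A for A :: "'a star_algebra" (structure) +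
  fixes \<Lambda> :: "'i set" and r :: "'i rel" and p :: "'i \<Rightarrow> 'a \<Rightarrow> real"
  assumes locally_cstar: "locally_cstar_algebra A \<Lambda> r p"
begin

lemma cstar_seminormed: "\<alpha> \<in> \<Lambda> \<Longrightarrow> cstar_seminormed A (p \<alpha>)"
  using locally_cstar by unfold_locales (simp add: locally_cstar_algebra_def)

lemma openin_seminorm_ball:
  assumes \<alpha>: "\<alpha> \<in> \<Lambda>" and b: "b \<in> carrier A"
  shows "openin (seminorm_topology A \<Lambda> p) {y \<in> carrier A. p \<alpha> (y \<ominus> b) < e}"
  unfolding openin_seminorm_topology
proof (intro conjI ballI)
  interpret P: cstar_seminormed A "p \<alpha>" by (rule cstar_seminormed[OF \<alpha>])
  fix x assume x: "x \<in> {y \<in> carrier A. p \<alpha> (y \<ominus> b) < e}"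
  have "p \<alpha> (y \<ominus> b) < e" if "y \<in> carrier A" "p \<alpha> (y \<ominus> x) < e - p \<alpha> (x \<ominus> b)" for y
    using P.p_add[of "y \<ominus> x" "x \<ominus> b"] diff_split[of y x b] that x b by simp
  then show "\<exists>F d. finite F \<and> F \<subseteq> \<Lambda> \<and> 0 < d \<and>
      {y \<in> carrier A. \<forall>\<alpha>\<in>F. p \<alpha> (y \<ominus> x) < d} \<subseteq> {y \<in> carrier A. p \<alpha> (y \<ominus> b) < e}"
    using x \<alpha> by (intro exI[of _ "{\<alpha>}"] exI[of _ "e - p \<alpha> (x \<ominus> b)"]) auto
qed auto

lemma bounded_characters_mono:
  assumes "(\<alpha>, \<beta>) \<in> r"
  shows "bounded_characters A (p \<alpha>) \<subseteq> bounded_characters A (p \<beta>)"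
proof -
  have "p \<alpha> x \<le> p \<beta> x" if "x \<in> carrier A" for x
    using locally_cstar assms that by (auto simp: locally_cstar_algebra_def upward_filtered_def)
  then show ?thesis unfolding bounded_characters_def by (blast intro: order_trans)
qed

text \<open>Completeness enters here: the approximations of \<open>f h\<close> by polynomials in \<open>h\<close>, taken over
  all \<open>\<alpha>\<close>, form a Cauchy filter. On the quotient \<open>A\<^sub>\<alpha>\<close> alone this could not be
  done, as its completeness is not known in advance.\<close>

lemma continuous_calculus:
  fixes f :: "real \<Rightarrow> real"
  assumes f: "continuous_on UNIV f" and h: "h \<in> carrier A" "invol A h = h"
  shows "\<exists>b\<in>carrier A. \<forall>\<alpha>\<in>\<Lambda>. \<forall>\<phi>\<in>bounded_characters A (p \<alpha>). \<phi> b = of_real (f (Re (\<phi> h)))"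
proof -
  \<comment> \<open>These are the approximants of the sought element at level \<alpha> with error
    \<open>e\<close>; they form a base of the filter \<open>F\<close>.\<close>
  define S where "S = (\<lambda>(\<alpha>, e). {b \<in> carrier A. \<forall>\<phi>\<in>bounded_characters A (p \<alpha>).
      cmod (\<phi> b - of_real (f (Re (\<phi> h)))) < e})"
  define B where "B = \<Lambda> \<times> {0::real<..}"
  define F where "F = (INF i\<in>B. principal (S i))"
  have dir: "directed_poset \<Lambda> r" and complete: "seminorm_complete A \<Lambda> p"
    using locally_cstar by (auto simp: locally_cstar_algebra_def)
  have "B \<noteq> {}" using dir by (auto simp: B_def directed_poset_def intro: exI[of _ 1])
  \<comment> \<open>A larger index has more bounded characters, so its condition is stronger; an
    upper bound of both indices and the smaller error serve.\<close>
  have directed: "\<exists>k\<in>B. S k \<subseteq> S i \<inter> S j" if "i \<in> B" "j \<in> B" for i j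
  proof -
    obtain \<alpha> d \<beta> e where ij: "i = (\<alpha>, d)" "j = (\<beta>, e)" by (metis surj_pair)
    obtain \<gamma> where \<gamma>: "\<gamma> \<in> \<Lambda>" "(\<alpha>, \<gamma>) \<in> r" "(\<beta>, \<gamma>) \<in> r"
      using dir \<open>i \<in> B\<close> \<open>j \<in> B\<close> by (auto simp: B_def directed_poset_def ij)
    have "S (\<gamma>, min d e) \<subseteq> S i \<inter> S j"
      using bounded_characters_mono[OF \<gamma>(2)] bounded_characters_mono[OF \<gamma>(3)]
      by (auto simp: S_def ij)
    then show ?thesis
      using \<gamma>(1) \<open>i \<in> B\<close> \<open>j \<in> B\<close> by (intro bexI[of _ "(\<gamma>, min d e)"]) (auto simp: B_def ij)
  qed
  have eventually_F: "eventually Q F \<longleftrightarrow> (\<exists>i\<in>B. \<forall>x\<in>S i. Q x)" for Q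
    unfolding F_def using directed
    by (subst eventually_INF_base[OF \<open>B \<noteq> {}\<close>]) (auto simp: eventually_principal)
  have nonempty: "S i \<noteq> {}" if "i \<in> B" for i
  proof -
    obtain \<alpha> e where "i = (\<alpha>, e)" by (cases i)
    then have i: "i = (\<alpha>, e)" "\<alpha> \<in> \<Lambda>" "0 < e" using that by (auto simp: B_def)
    show ?thesis
      using cstar_seminormed.approximate_calculus[OF cstar_seminormed[OF i(2)] f h i(3)]
      unfolding i(1) S_def by blast
  qed
  have in_S: "eventually (\<lambda>x. x \<in> S i) F" if "i \<in> B" for i
    using that by (auto simp: eventually_F)
  have "F \<noteq> bot"
    using nonempty by (auto simp: trivial_limit_def eventually_F)
  have "cauchy_filter A \<Lambda> p F"
    unfolding cauchy_filter_def
  proof (intro conjI ballI allI impI)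
    show "F \<le> principal (carrier A)"
      using \<open>B \<noteq> {}\<close> by (auto simp: le_principal eventually_F S_def)
    fix \<alpha> and e :: real assume \<alpha>: "\<alpha> \<in> \<Lambda>" and e: "0 < e"
    interpret P: cstar_seminormed A "p \<alpha>" by (rule cstar_seminormed[OF \<alpha>])
    \<comment> \<open>A character attaining the seminorm of the difference turns closeness to the
      common value of \<open>f\<close> into a seminorm estimate.\<close>
    have "p \<alpha> (x \<ominus> y) < e" if xy: "x \<in> S (\<alpha>, e / 2)" "y \<in> S (\<alpha>, e / 2)" for x y
    proof -
      have xy': "x \<in> carrier A" "y \<in> carrier A" using xy by (auto simp: S_def)
      obtain \<phi> where \<phi>: "\<phi> \<in> bounded_characters A (p \<alpha>)" "cmod (\<phi> (x \<ominus> y)) = p \<alpha> (x \<ominus> y)"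
        using P.exists_bounded_character[of "x \<ominus> y"] xy' by auto
      have "p \<alpha> (x \<ominus> y) = cmod (\<phi> x - \<phi> y)"
        using \<phi> character_diff[of \<phi> x y] xy' by (simp add: bounded_characters_def)
      also have "\<dots> \<le> cmod (\<phi> x - of_real (f (Re (\<phi> h)))) + cmod (\<phi> y - of_real (f (Re (\<phi> h))))"
        using norm_triangle_ineq4[of "\<phi> x - of_real (f (Re (\<phi> h)))" "\<phi> y - of_real (f (Re (\<phi> h)))"]
        by simp
      also have "\<dots> < e / 2 + e / 2"
        using \<phi>(1) xy by (intro add_strict_mono) (auto simp: S_def)
      also have "\<dots> = e" by simp
      finally show ?thesis .
    qed
    then show "\<exists>T. eventually (\<lambda>x. x \<in> T) F \<and> T \<subseteq> carrier A \<and> (\<forall>x\<in>T. \<forall>y\<in>T. p \<alpha> (x \<ominus> y) < e)"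
      using \<alpha> e by (intro exI[of _ "S (\<alpha>, e / 2)"] conjI in_S) (auto simp: B_def S_def)
  qed (use \<open>F \<noteq> bot\<close> in auto)
  then obtain b where b: "limitin (seminorm_topology A \<Lambda> p) (\<lambda>x. x) b F"
    using complete by (auto simp: seminorm_complete_def)
  have "b \<in> carrier A"
    using limitin_topspace[OF b] openin_subset[of "seminorm_topology A \<Lambda> p"]
      openin_seminorm_topology[of A \<Lambda> p "topspace (seminorm_topology A \<Lambda> p)"] by auto
  have "\<phi> b = of_real (f (Re (\<phi> h)))"
    if \<alpha>: "\<alpha> \<in> \<Lambda>" and \<phi>: "\<phi> \<in> bounded_characters A (p \<alpha>)" for \<alpha> \<phi>
  proof -
    interpret P: cstar_seminormed A "p \<alpha>" by (rule cstar_seminormed[OF \<alpha>])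
    \<comment> \<open>A bounded character is continuous for \<open>p \<alpha>\<close>, so an
      approximant \<open>x\<close> close to the limit \<open>b\<close> links the two values.\<close>
    have "cmod (\<phi> b - of_real (f (Re (\<phi> h)))) \<le> 0 + e" if e: "0 < e" for e
    proof -
      have "eventually (\<lambda>x. x \<in> {y \<in> carrier A. p \<alpha> (y \<ominus> b) < e / 2}) F"
        using b openin_seminorm_ball[OF \<alpha> \<open>b \<in> carrier A\<close>, of "e / 2"] \<open>b \<in> carrier A\<close> e
        by (auto simp: limitin_def a_minus_def r_neg)
      moreover have "eventually (\<lambda>x. x \<in> S (\<alpha>, e / 2)) F"
        using \<alpha> e by (intro in_S) (auto simp: B_def)
      ultimately have "eventually (\<lambda>x. x \<in> S (\<alpha>, e / 2) \<and> x \<in> carrier A \<and> p \<alpha> (x \<ominus> b) < e / 2) F"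
        by eventually_elim auto
      then obtain x where x: "x \<in> S (\<alpha>, e / 2)" "x \<in> carrier A" "p \<alpha> (x \<ominus> b) < e / 2"
        using eventually_happens'[OF \<open>F \<noteq> bot\<close>] by blast
      have "cmod (\<phi> (x \<ominus> b)) \<le> p \<alpha> (x \<ominus> b)"
        using \<phi> x(2) \<open>b \<in> carrier A\<close> by (simp add: bounded_characters_def)
      then have "cmod (\<phi> x - \<phi> b) \<le> p \<alpha> (x \<ominus> b)"
        using \<phi> x(2) \<open>b \<in> carrier A\<close> by (simp add: bounded_characters_def character_diff)
      then have "cmod (\<phi> b - \<phi> x) < e / 2" using x(3) by (simp add: norm_minus_commute)
      moreover have "cmod (\<phi> x - of_real (f (Re (\<phi> h)))) < e / 2"
        using x(1) \<phi> by (auto simp: S_def)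
      ultimately show ?thesis
        using norm_triangle_ineq[of "\<phi> b - \<phi> x" "\<phi> x - of_real (f (Re (\<phi> h)))"] by simp
    qed
    then have "cmod (\<phi> b - of_real (f (Re (\<phi> h)))) \<le> 0" by (rule field_le_epsilon)
    then show ?thesis by simp
  qed
  then show ?thesis using \<open>b \<in> carrier A\<close> by blast
qed

section \<open>Characters vanishing on the kernel of one seminorm\<close>

context
  fixes \<alpha> \<phi>
  assumes \<alpha>: "\<alpha> \<in> \<Lambda>" and \<phi>: "\<phi> \<in> characters A"
    and null: "\<And>x. \<lbrakk>x \<in> carrier A; p \<alpha> x = 0\<rbrakk> \<Longrightarrow> \<phi> x = 0"
begin

interpretation P: cstar_seminormed A "p \<alpha>"
  by (rule cstar_seminormed[OF \<alpha>])

text \<open>Reality and the bound fail together exactly when \<open>t\<close> lies off the interval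
  \<open>[- M, M]\<close>. In that case \<open>(h - cnj t) (h - t)\<close> acquires an inverse
  modulo the kernel, although \<open>\<phi>\<close> vanishes at it.\<close>

lemma character_self_adjoint:
  assumes h: "h \<in> carrier A" "invol A h = h"
  shows "\<phi> h = of_real (Re (\<phi> h)) \<and> \<bar>Re (\<phi> h)\<bar> \<le> p \<alpha> h"
proof (rule ccontr)
  assume neg: "\<not> ?thesis"
  define t where "t = \<phi> h"
  define M where "M = p \<alpha> h"
  \<comment> \<open>Retracting the line onto \<open>[- M, M]\<close> keeps the denominator below
    nonzero everywhere, as a calculus on the whole line requires, and changes nothing at the values
    of bounded characters at \<open>h\<close>.\<close>
  define clip where "clip = (\<lambda>x. max (- M) (min M x))"
  have M: "0 \<le> M" using h by (simp add: M_def)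
  have clip_bound: "\<bar>clip x\<bar> \<le> M" for x using M by (auto simp: clip_def)
  have off: "of_real (clip x) \<noteq> t" for x
    using neg clip_bound[of x] by (auto simp: t_def[symmetric] M_def[symmetric])
  have "continuous_on UNIV (\<lambda>x. 1 / (cmod (of_real (clip x) - t))\<^sup>2)"
    unfolding clip_def using off by (intro continuous_intros) (auto simp: clip_def)
  then obtain b where b: "b \<in> carrier A" "\<forall>\<beta>\<in>\<Lambda>. \<forall>\<rho>\<in>bounded_characters A (p \<beta>).
      \<rho> b = of_real (1 / (cmod (of_real (clip (Re (\<rho> h))) - t))\<^sup>2)"
    using continuous_calculus[OF _ h] by blast
  \<comment> \<open>At a real \<open>s\<close> the product of \<open>s - cnj t\<close> and
    \<open>s - t\<close> is \<open>(cmod (s - t))\<^sup>2\<close>, so the real-valued calculus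
    suffices to invert it.\<close>
  define c where "c = b \<otimes> ((h \<ominus> \<iota> (cnj t)) \<otimes> (h \<ominus> \<iota> t)) \<ominus> \<one>"
  have c: "c \<in> carrier A" using b(1) h by (simp add: c_def)
  have eval: "\<rho> c = \<rho> b * ((\<rho> h - cnj t) * (\<rho> h - t)) - 1" if "\<rho> \<in> characters A" for \<rho>
    using that b(1) h
    by (simp add: c_def character_diff character_mult character_one character_scal)
  \<comment> \<open>As \<open>\<rho>\<close> attains \<open>p \<alpha> c\<close>, showing
    \<open>\<rho> c = 0\<close> puts \<open>c\<close> into the kernel, where \<open>\<phi>\<close>
    vanishes.\<close>
  obtain \<rho> where \<rho>: "\<rho> \<in> bounded_characters A (p \<alpha>)" "cmod (\<rho> c) = p \<alpha> c"
    using P.exists_bounded_character[OF c] by blast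
  define s where "s = Re (\<rho> h)"
  have s: "\<rho> h = of_real s" unfolding s_def by (rule P.bounded_character_self_adjoint[OF \<rho>(1) h])
  have "s \<in> {- M .. M}"
    using P.bounded_character_in_interval[OF \<rho>(1) h(1)] by (simp add: M_def s_def)
  then have clip: "clip s = s" by (auto simp: clip_def)
  have "(of_real s - cnj t) * (of_real s - t) = of_real ((cmod (of_real s - t))\<^sup>2)"
    using complex_norm_square[of "of_real s - t"] by (simp add: mult.commute)
  moreover have "\<rho> b = of_real (1 / (cmod (of_real s - t))\<^sup>2)"
    using bspec[OF bspec[OF b(2) \<alpha>] \<rho>(1)] unfolding s_def[symmetric] clip .
  moreover have "cmod (of_real s - t) \<noteq> 0" using off[of s] clip by simp
  ultimately have "\<rho> c = 0"
    using eval[of \<rho>] \<rho>(1) by (simp add: s bounded_characters_def)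
  then have "\<phi> c = 0" using \<rho>(2) c by (intro null) auto
  \<comment> \<open>At \<open>\<phi>\<close> itself the factor \<open>\<phi> h - t\<close> is 0, so
    \<open>\<phi> c\<close> would be -1.\<close>
  then show False using eval[OF \<phi>] by (simp add: t_def)
qed

text \<open>The sum of an element and its adjoint is self-adjoint and has a real value. For
  \<open>x\<close> this compares the imaginary parts, for \<open>\<i> \<odot> x\<close> the real
  parts.\<close>

lemma character_invol:
  assumes x: "x \<in> carrier A"
  shows "\<phi> (invol A x) = cnj (\<phi> x)"
proof -
  have "\<phi> (y \<oplus> invol A y) = of_real (Re (\<phi> (y \<oplus> invol A y)))" if "y \<in> carrier A" for y
    using character_self_adjoint[of "y \<oplus> invol A y"] that
    by (simp add: invol_add invol_invol a_comm)
  then have im: "Im (\<phi> y + \<phi> (invol A y)) = 0" if "y \<in> carrier A" for y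
    using that by (metis Im_complex_of_real character_add[OF \<phi>] invol_closed)
  have "Im (\<phi> x + \<phi> (invol A x)) = 0" by (rule im[OF x])
  moreover have "Im (\<i> * \<phi> x + - \<i> * \<phi> (invol A x)) = 0"
    using im[of "\<i> \<odot> x"] x by (simp add: invol_smult character_smult[OF \<phi>])
  ultimately show ?thesis by (simp add: complex_eq_iff)
qed

text \<open>The self-adjoint bound at the adjoint of \<open>x\<close> times \<open>x\<close>, with
  the C*-identity and hermiticity, gives the squared inequality.\<close>

lemma character_bounded: "\<phi> \<in> bounded_characters A (p \<alpha>)"
proof -
  have "cmod (\<phi> x) \<le> p \<alpha> x" if x: "x \<in> carrier A" for x
  proof -
    define y where "y = invol A x \<otimes> x"
    have y: "y \<in> carrier A" "invol A y = y"
      using x by (simp_all add: y_def invol_mult invol_invol)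
    have "\<phi> y = of_real ((cmod (\<phi> x))\<^sup>2)"
      using x complex_norm_square[of "\<phi> x"]
      by (simp add: y_def character_mult[OF \<phi>] character_invol mult.commute)
    then have "(cmod (\<phi> x))\<^sup>2 \<le> p \<alpha> y"
      using character_self_adjoint[OF y] by simp
    then have "(cmod (\<phi> x))\<^sup>2 \<le> (p \<alpha> x)\<^sup>2"
      unfolding y_def using P.p_star_self[OF x] by simp
    then show ?thesis using power2_le_imp_le P.p_nonneg[OF x] by blast
  qed
  then show ?thesis using \<phi> by (simp add: bounded_characters_def)
qed

end

end

section \<open>Quotients and the Gelfand map\<close>

context cstar_seminormed
begin

lemma ideal_null_ideal: "ideal (null_ideal A p) A"
proof (rule idealI[OF ring_axioms])
  have null: "p x = 0" if "x \<in> carrier A" "p x \<le> 0" for x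
    using that p_nonneg[of x] by (intro antisym)
  show "subgroup (null_ideal A p) (add_monoid A)"
  proof (rule add.subgroupI)
    show "null_ideal A p \<noteq> {}" using p_zero by (auto simp: null_ideal_def)
    show "a \<oplus> b \<in> null_ideal A p" if "a \<in> null_ideal A p" "b \<in> null_ideal A p" for a b
      using p_add[of a b] that null[of "a \<oplus> b"] by (simp add: null_ideal_def)
  qed (auto simp: null_ideal_def p_uminus)
  fix a x assume "a \<in> null_ideal A p" "x \<in> carrier A"
  then show "x \<otimes> a \<in> null_ideal A p" "a \<otimes> x \<in> null_ideal A p"
    using p_mult[of x a] p_mult[of a x] null[of "x \<otimes> a"] null[of "a \<otimes> x"]
    by (simp_all add: null_ideal_def)
qed

lemma abelian_subgroup_null_ideal: "abelian_subgroup (null_ideal A p) A"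
  using ideal_null_ideal abelian_group_axioms
  by (intro abelian_subgroupI3 ideal.axioms(1))

lemma quot_map_eq_iff:
  "\<lbrakk>a \<in> carrier A; b \<in> carrier A\<rbrakk> \<Longrightarrow> quot_map A p a = quot_map A p b \<longleftrightarrow> p (a \<ominus> b) = 0"
  using quotient_eq_iff_same_a_r_cos[OF ideal_null_ideal, of a b]
  by (simp add: quot_map_def null_ideal_def)

lemma mem_quot_map:
  assumes a: "a \<in> carrier A"
  shows "x \<in> quot_map A p a \<longleftrightarrow> x \<in> carrier A \<and> quot_map A p x = quot_map A p a"
proof
  assume x: "x \<in> quot_map A p a"
  then have "x \<in> null_ideal A p +> a" using a by (simp add: quot_map_def)
  then have "x \<in> carrier A" "null_ideal A p +> a = null_ideal A p +> x"
    using abelian_subgroup.a_elemrcos_carrier[OF abelian_subgroup_null_ideal a] abelian_subgroup.a_repr_independence'[OF abelian_subgroup_null_ideal _ a] by blast+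
  then show "x \<in> carrier A \<and> quot_map A p x = quot_map A p a" using a by (simp add: quot_map_def)
next
  assume "x \<in> carrier A \<and> quot_map A p x = quot_map A p a"
  then have "x \<in> carrier A" "quot_map A p x = quot_map A p a" by auto
  then show "x \<in> quot_map A p a" using a abelian_subgroup.a_rcos_self[OF abelian_subgroup_null_ideal, of x] by (simp add: quot_map_def)
qed

lemma quot_map_closed: "a \<in> carrier A \<Longrightarrow> quot_map A p a \<in> carrier (quot_algebra A p)"
  by (auto simp flip: quot_map_surj)

lemma quot_map_add:
  "\<lbrakk>a \<in> carrier A; b \<in> carrier A\<rbrakk> \<Longrightarrow>
    quot_map A p a \<oplus>\<^bsub>quot_algebra A p\<^esub> quot_map A p b = quot_map A p (a \<oplus> b)"
  by (simp add: quot_map_def quot_algebra_def Let_def FactRing_def ideal.a_rcos_sum[OF ideal_null_ideal])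

lemma quot_map_mult:
  "\<lbrakk>a \<in> carrier A; b \<in> carrier A\<rbrakk> \<Longrightarrow>
    quot_map A p a \<otimes>\<^bsub>quot_algebra A p\<^esub> quot_map A p b = quot_map A p (a \<otimes> b)"
  by (simp add: quot_map_def quot_algebra_def Let_def FactRing_def ideal.rcoset_mult_add[OF ideal_null_ideal])

text \<open>Scalar multiplication and involution of a coset are unions over its representatives. If
  \<open>g\<close> respects the kernel, all sets in the union coincide, and \<open>a\<close> itself
  shows that the union is not empty.\<close>

lemma UN_quot_map:
  assumes a: "a \<in> carrier A" and g: "\<And>x. x \<in> carrier A \<Longrightarrow> g x \<in> carrier A"
    and cong: "\<And>x. \<lbrakk>x \<in> carrier A; p (x \<ominus> a) = 0\<rbrakk> \<Longrightarrow> p (g x \<ominus> g a) = 0"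
  shows "(\<Union>x\<in>quot_map A p a. null_ideal A p +> g x) = quot_map A p (g a)"
proof -
  have "null_ideal A p +> g x = quot_map A p (g a)" if "x \<in> quot_map A p a" for x
  proof -
    have "x \<in> carrier A" "quot_map A p x = quot_map A p a"
      using that mem_quot_map[OF a, of x] by auto
    then have "quot_map A p (g x) = quot_map A p (g a)"
      using a g[of x] g[of a] cong[of x] quot_map_eq_iff[of x a] quot_map_eq_iff[of "g x" "g a"] by simp
    then show ?thesis using g[OF \<open>x \<in> carrier A\<close>] by (simp add: quot_map_def)
  qed
  moreover have "a \<in> quot_map A p a" using a by (simp add: mem_quot_map)
  ultimately show ?thesis by blast
qed

lemma quot_map_smult:
  assumes a: "a \<in> carrier A"
  shows "c \<odot>\<^bsub>quot_algebra A p\<^esub> quot_map A p a = quot_map A p (c \<odot> a)"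
proof -
  have "p (c \<odot> x \<ominus> c \<odot> a) = 0" if "x \<in> carrier A" "p (x \<ominus> a) = 0" for x
    using that a by (simp add: smult_diff[symmetric] p_smult)
  then show ?thesis
    using UN_quot_map[OF a, of "\<lambda>x. c \<odot> x"] by (simp add: quot_algebra_def Let_def)
qed

lemma quot_map_invol:
  assumes a: "a \<in> carrier A"
  shows "invol (quot_algebra A p) (quot_map A p a) = quot_map A p (invol A a)"
proof -
  have "p (invol A x \<ominus> invol A a) = 0" if x: "x \<in> carrier A" "p (x \<ominus> a) = 0" for x
  proof -
    have "invol A (\<ominus> a) = \<ominus> invol A a"
      using a invol_smult[of a "- 1"] by (simp add: uminus_eq_smult)
    then have "invol A x \<ominus> invol A a = invol A (x \<ominus> a)"
      using a x by (simp add: a_minus_def invol_add)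
    then show ?thesis using a x p_invol[of "x \<ominus> a"] by simp
  qed
  then show ?thesis
    using UN_quot_map[OF a, of "invol A"] by (simp add: quot_algebra_def Let_def)
qed

lemma carrier_quot_algebraE:
  assumes "X \<in> carrier (quot_algebra A p)"
  obtains a where "a \<in> carrier A" "X = quot_map A p a"
  using assms by (auto simp flip: quot_map_surj)

lemma pullback_map_apply: "a \<in> carrier A \<Longrightarrow> pullback_map A p \<phi> a = \<phi> (quot_map A p a)"
  by (simp add: pullback_map_def compose_def)

lemma quot_character_null:
  assumes \<phi>: "\<phi> \<in> characters (quot_algebra A p)" and x: "x \<in> carrier A" "p x = 0"
  shows "pullback_map A p \<phi> x = 0"
proof -
  \<comment> \<open>Writing the zero class as that of \<open>0 \<odot> x\<close> lets homogeneity
    produce the value 0.\<close>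
  have "quot_map A p x = quot_map A p (0 \<odot> x)"
    using x by (simp add: quot_map_eq_iff smult_eq_scal[of x 0] scal_zero a_minus_def)
  then have "\<phi> (quot_map A p x) = \<phi> (0 \<odot>\<^bsub>quot_algebra A p\<^esub> quot_map A p x)"
    unfolding quot_map_smult[OF x(1)] by (rule arg_cong)
  also have "\<dots> = 0 * \<phi> (quot_map A p x)"
    using \<phi> quot_map_closed[OF x(1)] unfolding characters_def by blast
  finally show ?thesis using x(1) by (simp add: pullback_map_apply)
qed

lemma pullback_character:
  assumes \<phi>: "\<phi> \<in> characters (quot_algebra A p)"
  shows "pullback_map A p \<phi> \<in> characters A"
proof -
  have *: "\<phi> (quot_map A p (x \<oplus> y)) = \<phi> (quot_map A p x) + \<phi> (quot_map A p y)"
      "\<phi> (quot_map A p (x \<otimes> y)) = \<phi> (quot_map A p x) * \<phi> (quot_map A p y)"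
    if "x \<in> carrier A" "y \<in> carrier A" for x y
    using \<phi> that quot_map_closed
    by (auto simp: characters_def simp flip: quot_map_add quot_map_mult)
  have **: "\<phi> (quot_map A p (c \<odot> x)) = c * \<phi> (quot_map A p x)" if "x \<in> carrier A" for c x
    using \<phi> that quot_map_closed by (auto simp: characters_def simp flip: quot_map_smult)
  obtain X where "X \<in> carrier (quot_algebra A p)" "\<phi> X \<noteq> 0" using \<phi> by (auto simp: characters_def)
  then obtain a where "a \<in> carrier A" "\<phi> (quot_map A p a) \<noteq> 0" by (metis carrier_quot_algebraE)
  then have "\<exists>a\<in>carrier A. pullback_map A p \<phi> a \<noteq> 0" by (auto simp: pullback_map_apply)
  moreover have "pullback_map A p \<phi> \<in> extensional (carrier A)"
    by (simp add: pullback_map_def compose_def)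
  ultimately show ?thesis
    using * ** by (simp add: characters_def pullback_map_apply)
qed

text \<open>The bound makes \<open>\<psi>\<close> constant on cosets, so evaluating it at an
  arbitrarily chosen representative is well defined and respects the operations.\<close>

lemma bounded_character_pushforward:
  assumes bounded: "\<psi> \<in> bounded_characters A p"
  obtains \<phi> where "\<phi> \<in> characters (quot_algebra A p)"
    "\<And>a. a \<in> carrier A \<Longrightarrow> \<phi> (quot_map A p a) = \<psi> a"
proof -
  have \<psi>: "\<psi> \<in> characters A" "\<And>x. x \<in> carrier A \<Longrightarrow> cmod (\<psi> x) \<le> p x"
    using bounded by (auto simp: bounded_characters_def)
  define \<phi> where "\<phi> = (\<lambda>X\<in>carrier (quot_algebra A p). \<psi> (SOME a. a \<in> carrier A \<and> quot_map A p a = X))"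
  have eval: "\<phi> (quot_map A p a) = \<psi> a" if a: "a \<in> carrier A" for a
  proof -
    define b where "b = (SOME b. b \<in> carrier A \<and> quot_map A p b = quot_map A p a)"
    have b: "b \<in> carrier A \<and> quot_map A p b = quot_map A p a"
      unfolding b_def by (rule someI[of _ a]) (use a in simp)
    then have "p (b \<ominus> a) = 0" using a quot_map_eq_iff by blast
    then have "cmod (\<psi> (b \<ominus> a)) \<le> 0" using \<psi>(2)[of "b \<ominus> a"] a b by simp
    then have "\<psi> b = \<psi> a" using character_diff[OF \<psi>(1), of b a] a b by simp
    then show ?thesis using quot_map_closed[OF a] by (simp add: \<phi>_def b_def)
  qed
  have "\<phi> \<in> characters (quot_algebra A p)"
    unfolding characters_def
  proof (intro CollectI conjI ballI allI)
    fix X Y assume "X \<in> carrier (quot_algebra A p)" "Y \<in> carrier (quot_algebra A p)"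
    then obtain a b where "a \<in> carrier A" "X = quot_map A p a" "b \<in> carrier A" "Y = quot_map A p b"
      by (metis carrier_quot_algebraE)
    then show "\<phi> (X \<oplus>\<^bsub>quot_algebra A p\<^esub> Y) = \<phi> X + \<phi> Y" "\<phi> (X \<otimes>\<^bsub>quot_algebra A p\<^esub> Y) = \<phi> X * \<phi> Y"
      by (simp_all add: quot_map_add quot_map_mult eval character_add[OF \<psi>(1)] character_mult[OF \<psi>(1)])
  next
    fix c X assume "X \<in> carrier (quot_algebra A p)"
    then obtain a where "a \<in> carrier A" "X = quot_map A p a" by (metis carrier_quot_algebraE)
    then show "\<phi> (c \<odot>\<^bsub>quot_algebra A p\<^esub> X) = c * \<phi> X"
      by (simp add: quot_map_smult eval character_smult[OF \<psi>(1)])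
  next
    show "\<exists>X\<in>carrier (quot_algebra A p). \<phi> X \<noteq> 0"
      using quot_map_closed[of \<one>] eval[of \<one>] character_one[OF \<psi>(1)]
      by (intro bexI[of _ "quot_map A p \<one>"]) auto
  qed (simp add: \<phi>_def)
  then show ?thesis using eval that by blast
qed

end

lemma continuous_map_evaluation:
  assumes "X \<in> carrier B"
  shows "continuous_map (weak_star_topology B) euclidean (\<lambda>\<phi>. \<phi> X)"
  unfolding weak_star_topology_def
  by (rule continuous_map_from_subtopology)
    (rule continuous_map_product_projection[OF assms, of "\<lambda>_. euclidean"])

section \<open>The Gelfand map: continuity, homomorphism laws and isometry\<close>

context commutative_locally_cstar_algebra
begin

text \<open>Characters of the quotient carry no continuity assumption; vanishing on the kernel
  suffices for the automatic bound.\<close>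

lemma pullback_bounded_character:
  assumes "\<alpha> \<in> \<Lambda>" "\<phi> \<in> characters (quot_algebra A (p \<alpha>))"
  shows "pullback_map A (p \<alpha>) \<phi> \<in> bounded_characters A (p \<alpha>)"
proof -
  interpret P: cstar_seminormed A "p \<alpha>" by (rule cstar_seminormed[OF assms(1)])
  show ?thesis
    by (rule character_bounded[OF assms(1) P.pullback_character[OF assms(2)]
          P.quot_character_null[OF assms(2)]])
qed

lemma pullback_invol:
  assumes "\<alpha> \<in> \<Lambda>" "\<phi> \<in> characters (quot_algebra A (p \<alpha>))" "x \<in> carrier A"
  shows "pullback_map A (p \<alpha>) \<phi> (invol A x) = cnj (pullback_map A (p \<alpha>) \<phi> x)"
proof -
  interpret P: cstar_seminormed A "p \<alpha>" by (rule cstar_seminormed[OF assms(1)])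
  show ?thesis
    by (rule character_invol[OF assms(1) P.pullback_character[OF assms(2)]
          P.quot_character_null[OF assms(2)] assms(3)])
qed

lemma character_spaceE:
  assumes "\<psi> \<in> character_space A \<Lambda> p"
  obtains \<alpha> \<phi> where "\<alpha> \<in> \<Lambda>" "\<phi> \<in> characters (quot_algebra A (p \<alpha>))" "\<psi> = pullback_map A (p \<alpha>) \<phi>"
  using assms by (auto simp: character_space_def Z_set_def)

lemma pullback_in_character_space:
  "\<lbrakk>\<alpha> \<in> \<Lambda>; \<phi> \<in> characters (quot_algebra A (p \<alpha>))\<rbrakk> \<Longrightarrow>
    pullback_map A (p \<alpha>) \<phi> \<in> character_space A \<Lambda> p"
  by (auto simp: character_space_def Z_set_def)

lemma character_space_characters: "character_space A \<Lambda> p \<subseteq> characters A"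
proof
  fix \<psi> assume "\<psi> \<in> character_space A \<Lambda> p"
  then obtain \<alpha> \<phi> where *: "\<alpha> \<in> \<Lambda>" "\<phi> \<in> characters (quot_algebra A (p \<alpha>))" "\<psi> = pullback_map A (p \<alpha>) \<phi>"
    by (rule character_spaceE)
  show "\<psi> \<in> characters A"
    unfolding *(3) by (rule cstar_seminormed.pullback_character[OF cstar_seminormed[OF *(1)] *(2)])
qed

text \<open>Every representation of \<open>\<psi>\<close> through a quotient yields the same number
  \<open>\<psi> a\<close>, so the definite description is well defined and the map is plain
  evaluation.\<close>

lemma gelfand_map_eval:
  assumes a: "a \<in> carrier A" and \<psi>: "\<psi> \<in> character_space A \<Lambda> p"
  shows "gelfand_map A \<Lambda> p a \<psi> = \<psi> a"
proof -
  have val: "\<phi> (quot_map A (p \<alpha>) a) = \<psi> a" if "\<alpha> \<in> \<Lambda>" "\<psi> = pullback_map A (p \<alpha>) \<phi>" for \<alpha> \<phi>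
    unfolding that(2) using cstar_seminormed.pullback_map_apply[OF cstar_seminormed[OF that(1)] a] by simp
  obtain \<alpha> \<phi> where \<phi>: "\<alpha> \<in> \<Lambda>" "\<phi> \<in> characters (quot_algebra A (p \<alpha>))" "\<psi> = pullback_map A (p \<alpha>) \<phi>"
    using \<psi> by (rule character_spaceE)
  have "(THE z. \<exists>\<alpha>\<in>\<Lambda>. \<exists>\<phi>\<in>characters (quot_algebra A (p \<alpha>)).
      \<psi> = pullback_map A (p \<alpha>) \<phi> \<and> z = \<phi> (quot_map A (p \<alpha>) a)) = \<psi> a"
  proof (rule the_equality)
    show "\<exists>\<alpha>\<in>\<Lambda>. \<exists>\<phi>\<in>characters (quot_algebra A (p \<alpha>)).
        \<psi> = pullback_map A (p \<alpha>) \<phi> \<and> \<psi> a = \<phi> (quot_map A (p \<alpha>) a)"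
      by (intro bexI conjI) (rule \<phi>(3) val[OF \<phi>(1,3), symmetric] \<phi>(2) \<phi>(1))+
  next
    fix z assume "\<exists>\<alpha>\<in>\<Lambda>. \<exists>\<phi>\<in>characters (quot_algebra A (p \<alpha>)).
        \<psi> = pullback_map A (p \<alpha>) \<phi> \<and> z = \<phi> (quot_map A (p \<alpha>) a)"
    then show "z = \<psi> a" by (elim bexE conjE) (rule trans[OF _ val])
  qed
  then show ?thesis using a \<psi> by (simp add: gelfand_map_def)
qed

lemma gelfand_map_extensional:
  "a \<in> carrier A \<Longrightarrow> gelfand_map A \<Lambda> p a \<in> extensional (character_space A \<Lambda> p)"
  by (simp add: gelfand_map_def)

lemma gelfand_map_pullback:
  assumes "a \<in> carrier A" "\<alpha> \<in> \<Lambda>" "\<phi> \<in> characters (quot_algebra A (p \<alpha>))"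
  shows "gelfand_map A \<Lambda> p a (pullback_map A (p \<alpha>) \<phi>) = \<phi> (quot_map A (p \<alpha>) a)"
  using assms gelfand_map_eval pullback_in_character_space
    cstar_seminormed.pullback_map_apply[OF cstar_seminormed] by simp

text \<open>By the inductive limit topology, preimages need only be checked on each
  \<open>Z_set\<close>, where they are images of open sets cut out by evaluation at the class of
  \<open>a\<close>.\<close>

lemma continuous_gelfand_map:
  assumes a: "a \<in> carrier A"
  shows "continuous_map (character_topology A \<Lambda> p) euclidean (gelfand_map A \<Lambda> p a)"
  unfolding continuous_map_def
proof (intro conjI allI impI)
  fix U :: "complex set" assume U: "openin euclidean U"
  let ?S = "{\<psi> \<in> character_space A \<Lambda> p. gelfand_map A \<Lambda> p a \<psi> \<in> U}"
  have "openin (Z_topology A (p \<alpha>)) (?S \<inter> Z_set A (p \<alpha>))" if \<alpha>: "\<alpha> \<in> \<Lambda>" for \<alpha>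
  proof -
    let ?W = "weak_star_topology (quot_algebra A (p \<alpha>))"
    let ?V = "{\<phi> \<in> topspace ?W. \<phi> (quot_map A (p \<alpha>) a) \<in> U}"
    have "openin ?W ?V"
      using continuous_map_evaluation[OF cstar_seminormed.quot_map_closed[OF cstar_seminormed[OF \<alpha>] a]] U
      by (rule openin_continuous_map_preimage)
    moreover have "?S \<inter> Z_set A (p \<alpha>) = pullback_map A (p \<alpha>) ` ?V"
      using gelfand_map_pullback[OF a \<alpha>] pullback_in_character_space[OF \<alpha>] by (auto simp: Z_set_def)
    ultimately show ?thesis unfolding openin_Z_topology by blast
  qed
  then show "openin (character_topology A \<Lambda> p)
      {\<psi> \<in> topspace (character_topology A \<Lambda> p). gelfand_map A \<Lambda> p a \<psi> \<in> U}"
    by (auto simp: openin_character_topology)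
qed simp

lemma gelfand_map_star_hom:
  "gelfand_map A \<Lambda> p \<in> star_hom A (cont_algebra (character_topology A \<Lambda> p))"
proof -
  let ?M = "character_space A \<Lambda> p"
  \<comment> \<open>Both sides are extensional, so each law in the function algebra reduces to the
    corresponding law for a single \<open>\<psi>\<close>.\<close>
  have eq: "gelfand_map A \<Lambda> p a = (\<lambda>\<psi>\<in>?M. F \<psi>)"
    if "a \<in> carrier A" "\<And>\<psi>. \<psi> \<in> ?M \<Longrightarrow> \<psi> a = F \<psi>" for a F
    using that by (intro extensionalityI[OF gelfand_map_extensional restrict_extensional])
      (simp_all add: gelfand_map_eval)
  have char: "\<psi> \<in> characters A" if "\<psi> \<in> ?M" for \<psi>
    using that character_space_characters by blast
  have star: "\<psi> (invol A a) = cnj (\<psi> a)" if "\<psi> \<in> ?M" "a \<in> carrier A" for \<psi> a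
    using that by (metis character_spaceE pullback_invol)
  show ?thesis
    unfolding star_hom_def cont_algebra_def
    by (auto simp: gelfand_map_extensional continuous_gelfand_map gelfand_map_eval character_add[OF char]
      character_mult[OF char] character_smult[OF char] star intro!: eq)
qed

lemma gelfand_map_one:
  "gelfand_map A \<Lambda> p \<one> = \<one>\<^bsub>cont_algebra (character_topology A \<Lambda> p)\<^esub>"
proof (rule extensionalityI[OF gelfand_map_extensional])
  fix \<psi> assume \<psi>: "\<psi> \<in> character_space A \<Lambda> p"
  then have "\<psi> \<in> characters A" using character_space_characters by blast
  then show "gelfand_map A \<Lambda> p \<one> \<psi> = \<one>\<^bsub>cont_algebra (character_topology A \<Lambda> p)\<^esub> \<psi>"
    using \<psi> by (simp add: gelfand_map_eval cont_algebra_def character_one)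
qed (simp_all add: cont_algebra_def)

lemma xi_map_gelfand_map:
  assumes "a \<in> carrier A" "\<alpha> \<in> \<Lambda>"
  shows "xi_map A (p \<alpha>) (gelfand_map A \<Lambda> p a) =
    (\<lambda>\<phi>\<in>characters (quot_algebra A (p \<alpha>)). \<phi> (quot_map A (p \<alpha>) a))"
  using gelfand_map_pullback[OF assms] by (auto simp: xi_map_def compose_def)

text \<open>Only compatibility with the involution is not built into \<open>characters\<close>; it
  is carried over from hermiticity of the pullback by choosing a representative.\<close>

lemma quotient_gelfand_star_hom:
  assumes \<alpha>: "\<alpha> \<in> \<Lambda>"
  shows "(\<lambda>X. \<lambda>\<phi>\<in>characters (quot_algebra A (p \<alpha>)). \<phi> X) \<in>
    star_hom (quot_algebra A (p \<alpha>)) (cont_algebra (weak_star_topology (quot_algebra A (p \<alpha>))))"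
proof -
  interpret P: cstar_seminormed A "p \<alpha>" by (rule cstar_seminormed[OF \<alpha>])
  let ?Q = "quot_algebra A (p \<alpha>)"
  have star: "\<phi> (invol ?Q X) = cnj (\<phi> X)" if \<phi>: "\<phi> \<in> characters ?Q" and X: "X \<in> carrier ?Q" for \<phi> X
  proof -
    obtain a where a: "a \<in> carrier A" "X = quot_map A (p \<alpha>) a" using X by (rule P.carrier_quot_algebraE)
    then show ?thesis
      using pullback_invol[OF \<alpha> \<phi> a(1)] by (simp add: P.quot_map_invol P.pullback_map_apply)
  qed
  have "\<phi> (X \<oplus>\<^bsub>?Q\<^esub> Y) = \<phi> X + \<phi> Y" "\<phi> (X \<otimes>\<^bsub>?Q\<^esub> Y) = \<phi> X * \<phi> Y"
    if "\<phi> \<in> characters ?Q" "X \<in> carrier ?Q" "Y \<in> carrier ?Q" for \<phi> X Y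
    using that by (auto simp: characters_def)
  moreover have "\<phi> (c \<odot>\<^bsub>?Q\<^esub> X) = c * \<phi> X" if "\<phi> \<in> characters ?Q" "X \<in> carrier ?Q" for \<phi> c X
    using that by (auto simp: characters_def)
  ultimately show ?thesis
    unfolding star_hom_def
    by (auto simp: cont_algebra_def continuous_map_evaluation star fun_eq_iff)
qed

text \<open>The supremum is a maximum: a bounded character attaining \<open>p \<alpha> a\<close>
  descends to the quotient, and every quotient character is bounded by
  \<open>p \<alpha>\<close>.\<close>

lemma local_isometric_gelfand_map: "local_isometric A \<Lambda> p (gelfand_map A \<Lambda> p)"
  unfolding local_isometric_def
proof (intro ballI)
  fix a \<alpha> assume a: "a \<in> carrier A" and \<alpha>: "\<alpha> \<in> \<Lambda>"
  interpret P: cstar_seminormed A "p \<alpha>" by (rule cstar_seminormed[OF \<alpha>])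
  let ?C = "characters (quot_algebra A (p \<alpha>))"
  have "q_seminorm A (p \<alpha>) (gelfand_map A \<Lambda> p a) = (SUP \<phi>\<in>?C. cmod (\<phi> (quot_map A (p \<alpha>) a)))"
    by (simp add: q_seminorm_def sup_norm_def xi_map_gelfand_map[OF a \<alpha>])
  also have "\<dots> = p \<alpha> a"
  proof (rule cSup_eq_maximum)
    obtain \<psi> where \<psi>: "\<psi> \<in> bounded_characters A (p \<alpha>)" "cmod (\<psi> a) = p \<alpha> a"
      using P.exists_bounded_character[OF a] by blast
    obtain \<phi> where "\<phi> \<in> ?C" "\<phi> (quot_map A (p \<alpha>) a) = \<psi> a"
      using P.bounded_character_pushforward[OF \<psi>(1)] a by metis
    then show "p \<alpha> a \<in> (\<lambda>\<phi>. cmod (\<phi> (quot_map A (p \<alpha>) a))) ` ?C"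
      using \<psi>(2) by (intro image_eqI[of _ _ \<phi>]) auto
  next
    fix t assume "t \<in> (\<lambda>\<phi>. cmod (\<phi> (quot_map A (p \<alpha>) a))) ` ?C"
    then obtain \<phi> where \<phi>: "\<phi> \<in> ?C" "t = cmod (\<phi> (quot_map A (p \<alpha>) a))" by blast
    then show "t \<le> p \<alpha> a"
      using pullback_bounded_character[OF \<alpha> \<phi>(1)] a
      by (auto simp: bounded_characters_def P.pullback_map_apply)
  qed
  finally show "q_seminorm A (p \<alpha>) (gelfand_map A \<Lambda> p a) = p \<alpha> a" .
qed

text \<open>The required net consists of the Gelfand transforms of the quotients, evaluation at a
  class.\<close>

lemma coherent_gelfand_map: "coherent_representation A \<Lambda> p (gelfand_map A \<Lambda> p)"
  unfolding coherent_representation_def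
  using gelfand_map_star_hom quotient_gelfand_star_hom xi_map_gelfand_map
  by (intro conjI exI[of _ "\<lambda>\<alpha> X. \<lambda>\<phi>\<in>characters (quot_algebra A (p \<alpha>)). \<phi> X"]) auto

end

theorem theorem3p3:
  fixes A :: "'a star_algebra" and \<Lambda> :: "'i set" and r :: "'i rel"
    and p :: "'i \<Rightarrow> 'a \<Rightarrow> real"
  assumes "locally_cstar_algebra A \<Lambda> r p"
    and "cring A"
  shows "let \<Gamma> = gelfand_map A \<Lambda> p in
           (\<forall>a\<in>carrier A. \<forall>\<alpha>\<in>\<Lambda>. \<forall>\<phi>\<in>characters (quot_algebra A (p \<alpha>)).
              \<Gamma> a (pullback_map A (p \<alpha>) \<phi>) = \<phi> (quot_map A (p \<alpha>) a)) \<and>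
           coherent_representation A \<Lambda> p \<Gamma> \<and>
           \<Gamma> \<one>\<^bsub>A\<^esub> = \<one>\<^bsub>cont_algebra (character_topology A \<Lambda> p)\<^esub> \<and>
           local_isometric A \<Lambda> p \<Gamma>"
proof -
  interpret complex_star_algebra A using assms(1) by (simp add: locally_cstar_algebra_def)
  interpret cring A by (rule assms(2))
  interpret commutative_locally_cstar_algebra A \<Lambda> r p
    by unfold_locales (rule assms(1))
  show ?thesis
    unfolding Let_def
    using gelfand_map_pullback coherent_gelfand_map gelfand_map_one local_isometric_gelfand_map by blast
qed

end
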